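(* Consider the hypothesis testing problem between probability measures $P=P_n$ and $Q=Q_n$ on $\mathbb R^{N_n}$. Assume that the low-degree heuristic holds for a related testing problem (the hidden informative sample problem defined in the context). If $\mathsf{Adv}_{\le D_n}(P_n;Q_n)^2\le\Delta_n$ for some $\Delta_n>1$, then there exists a constant $C>0$ such that there is no $(T_n;c_n;\epsilon_n)$-test between $P_n$ and $Q_n$ such that $$\log\Delta_n+(T_n+1)\log N_n\le D_n/C,\qquad c_n=\Omega(1),\qquad \epsilon_n\Delta_n=o(1).$$
   Context: Asymptotic notation is with respect to $n\to\infty$; $x_n\ll y_n$ means $x_n/y_n\to0$. $(T;c;\epsilon)$-test: a test $\mathcal A$ taking $\mathsf Y\in\mathbb R^{N}$ as input and outputting $0$ or $1$ is a $(T;c;\epsilon)$-test between $P$ and $Q$ if it can be calculated in time $O(N^{T})$, $P(\mathcal A(\mathsf Y)=1)\ge c$, and $Q(\mathcal A(\mathsf Y)=1)\le\epsilon$. Low-degree heuristic. Consider testing between probability measures $P=P_n$ and $Q=Q_n$ on $\mathbb R^{N}$, $N=N_n$. For a degree $D=D_n$ put $\mathsf{Adv}_{\le D}(P;Q)=\sup_f \mathbb E_P[f]/\sqrt{\mathbb E_Q[f^2]}$, the supremum over real polynomials $f$ on $\mathbb R^N$ of degree at most $D$. A $\{0,1\}$-valued algorithm $\mathcal A$ achieves strong detection if $Q(\mathcal A=1)+P(\mathcal A=0)\to0$, and weak detection if this sum is at most $1-\epsilon$ for some fixed $\epsilon>0$. The heuristic states: (1) if $\mathsf{Adv}_{\le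 D}(P;Q)=O(1)$, then there exists a constant $C$ such that no algorithm with running time $N^{D/(C\log N)}$ achieves strong detection between $P$ and $Q$; (2) if $\mathsf{Adv}_{\le D}(P;Q)=1+o(1)$, then there exists a constant $C$ such that no algorithm with running time $N^{D/(C\log N)}$ achieves weak detection between $P$ and $Q$. Hidden informative sample problem. Determine whether a sample $(\mathsf Y_1,\dots,\mathsf Y_M)$, each $\mathsf Y_i\in\mathbb R^N$, is generated under $\overline{\mathcal H}_0$: $\mathsf Y_1,\dots,\mathsf Y_M$ are independent samples from $Q_n$; or under $\overline{\mathcal H}_1$: $\kappa$ is uniform on $\{1,\dots,M\}$ and, given $\kappa$, the $\mathsf Y_j$ are independent with $\mathsf Y_\kappa\sim P_n$ and $\mathsf Y_j\sim Q_n$ for $j\neq\kappa$. Here the number of samples $M=M_n$ is chosen with $\Delta_n\ll M_n\le N_n\Delta_n$ and $\epsilon_nM_n=o(1)$, where $\Delta_n$ is the bound above and $\epsilon_n$ is the error parameter of the $(T_n;c_n;\epsilon_n)$-test to be ruled out. *)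

theory Defs
  imports "HOL-Probability.Probability"
begin

section \<open>Polynomials and the low-degree advantage\<close>

text \<open>Points of \<open>\<real>\<^sup>N\<close> are functions on the index set \<open>{..<N}\<close>.\<close>

definition Rn :: "nat \<Rightarrow> (nat \<Rightarrow> real) measure" where
  "Rn N = PiM {..<N} (\<lambda>_. borel)"

definition multi_indices :: "nat \<Rightarrow> nat \<Rightarrow> (nat \<Rightarrow> nat) set" where
  "multi_indices N D = {\<alpha>. (\<forall>i\<ge>N. \<alpha> i = 0) \<and> (\<Sum>i<N. \<alpha> i) \<le> D}"

definition polys_le :: "nat \<Rightarrow> nat \<Rightarrow> ((nat \<Rightarrow> real) \<Rightarrow> real) set" where
  "polys_le N D =
     {f. \<exists>a :: (nat \<Rightarrow> nat) \<Rightarrow> real. f = (\<lambda>y. \<Sum>\<alpha>\<in>multi_indices N D. a \<alpha> * (\<Prod>i<N. y i ^ \<alpha> i))}"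

text \<open>The advantage is an extended real. By the conventions for \<open>ereal\<close>, a quotient with zero
  denominator is \<open>\<infinity>\<close>, \<open>0\<close> or \<open>-\<infinity>\<close> according to the sign of the numerator. The expectations are
  Bochner integrals, so the definition is meaningful only if all polynomials of degree at most \<open>D\<close>
  are integrable under \<open>P\<close> and square integrable under \<open>Q\<close>.\<close>

definition Adv :: "nat \<Rightarrow> nat \<Rightarrow> (nat \<Rightarrow> real) measure \<Rightarrow> (nat \<Rightarrow> real) measure \<Rightarrow> ereal" where
  "Adv N D P Q =
     (SUP f\<in>polys_le N D. ereal (\<integral>y. f y \<partial>P) / ereal (sqrt (\<integral>y. (f y)\<^sup>2 \<partial>Q)))"

section \<open>Algorithms and running time\<close>

text \<open>Programs for a real RAM with unit cost: real registers, natural-number index registers, and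
  arrays of reals that can be accessed indirectly through index registers. There is deliberately no
  conversion from reals to indices (no floor function), and no division of indices, because unit-cost
  rounding would make the model unreasonably powerful.\<close>

datatype real_op = RAdd | RSub | RMul | RDiv

datatype index_op = IAdd | ISub | IMul

datatype guard = RLess nat nat | ILess nat nat

datatype program =
    Skip
  | RConst nat real
  | ROp real_op nat nat nat
  | IConst nat nat
  | IOp index_op nat nat nat
  | Input nat nat
  | Load nat nat nat
  | Store nat nat nat
  | Seq program program
  | Ite guard program program
  | While guard program

record state =
  rreg :: "nat \<Rightarrow> real"
  ireg :: "nat \<Rightarrow> nat"
  arr :: "nat \<Rightarrow> nat \<Rightarrow> real"

definition init_state :: state where
  "init_state = \<lparr>rreg = (\<lambda>_. 0), ireg = (\<lambda>_. 0), arr = (\<lambda>_ _. 0)\<rparr>"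

fun real_op_val :: "real_op \<Rightarrow> real \<Rightarrow> real \<Rightarrow> real" where
  "real_op_val RAdd x y = x + y"
| "real_op_val RSub x y = x - y"
| "real_op_val RMul x y = x * y"
| "real_op_val RDiv x y = x / y"

fun index_op_val :: "index_op \<Rightarrow> nat \<Rightarrow> nat \<Rightarrow> nat" where
  "index_op_val IAdd i j = i + j"
| "index_op_val ISub i j = i - j"
| "index_op_val IMul i j = i * j"

fun guard_val :: "guard \<Rightarrow> state \<Rightarrow> bool" where
  "guard_val (RLess r r') s \<longleftrightarrow> rreg s r < rreg s r'"
| "guard_val (ILess i i') s \<longleftrightarrow> ireg s i < ireg s i'"

text \<open>\<open>exec xs p s k s'\<close>: on the read-only input \<open>xs\<close>, program \<open>p\<close> started in \<open>s\<close> halts in \<open>s'\<close>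
  after \<open>k\<close> steps. Reading outside the input is an error, that is, there is no execution.\<close>

inductive exec :: "real list \<Rightarrow> program \<Rightarrow> state \<Rightarrow> nat \<Rightarrow> state \<Rightarrow> bool" for xs where
  Skip: "exec xs Skip s 1 s"
| RConst: "exec xs (RConst r x) s 1 (s\<lparr>rreg := (rreg s)(r := x)\<rparr>)"
| ROp: "exec xs (ROp f r r1 r2) s 1
    (s\<lparr>rreg := (rreg s)(r := real_op_val f (rreg s r1) (rreg s r2))\<rparr>)"
| IConst: "exec xs (IConst i m) s 1 (s\<lparr>ireg := (ireg s)(i := m)\<rparr>)"
| IOp: "exec xs (IOp f i i1 i2) s 1
    (s\<lparr>ireg := (ireg s)(i := index_op_val f (ireg s i1) (ireg s i2))\<rparr>)"
| Input: "ireg s i < length xs \<Longrightarrow>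
    exec xs (Input r i) s 1 (s\<lparr>rreg := (rreg s)(r := xs ! ireg s i)\<rparr>)"
| Load: "exec xs (Load r a i) s 1 (s\<lparr>rreg := (rreg s)(r := arr s a (ireg s i))\<rparr>)"
| Store: "exec xs (Store a i r) s 1
    (s\<lparr>arr := (arr s)(a := (arr s a)(ireg s i := rreg s r))\<rparr>)"
| Seq: "exec xs p s k s' \<Longrightarrow> exec xs q s' k' s'' \<Longrightarrow> exec xs (Seq p q) s (k + k') s''"
| IteTrue: "guard_val g s \<Longrightarrow> exec xs p s k s' \<Longrightarrow> exec xs (Ite g p q) s (k + 1) s'"
| IteFalse: "\<not> guard_val g s \<Longrightarrow> exec xs q s k s' \<Longrightarrow> exec xs (Ite g p q) s (k + 1) s'"
| WhileFalse: "\<not> guard_val g s \<Longrightarrow> exec xs (While g p) s 1 s"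
| WhileTrue: "guard_val g s \<Longrightarrow> exec xs p s k s' \<Longrightarrow> exec xs (While g p) s' k' s'' \<Longrightarrow>
    exec xs (While g p) s (k + k' + 1) s''"

inductive_cases exec_SeqE: "exec xs (Seq p q) s k s'"
inductive_cases exec_IteE: "exec xs (Ite g p q) s k s'"
inductive_cases exec_WhileE: "exec xs (While g p) s k s'"
inductive_cases exec_basicE:
  "exec xs Skip s k s'" "exec xs (RConst r x) s k s'" "exec xs (ROp f r r1 r2) s k s'"
  "exec xs (IConst i m) s k s'" "exec xs (IOp f i i1 i2) s k s'" "exec xs (Input r i) s k s'"
  "exec xs (Load r a i) s k s'" "exec xs (Store a i r) s k s'"

lemma exec_deterministic:
  assumes "exec xs p s k s'" and "exec xs p s m t"
  shows "k = m \<and> s' = t"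
  using assms
proof (induction arbitrary: m t rule: exec.induct)
  case (Seq p s k s' q k' s'')
  from Seq.prems show ?case by (rule exec_SeqE) (metis Seq.IH)
next
  case (IteTrue g s p k s' q)
  from IteTrue.prems show ?case by (rule exec_IteE) (metis IteTrue.IH IteTrue.hyps(1) Suc_eq_plus1)+
next
  case (IteFalse g s q k s' p)
  from IteFalse.prems show ?case by (rule exec_IteE) (metis IteFalse.IH IteFalse.hyps(1) Suc_eq_plus1)+
next
  case (WhileTrue g s p k s' k' s'')
  from WhileTrue.prems show ?case
    by (rule exec_WhileE) (metis WhileTrue.IH WhileTrue.hyps(1) Suc_eq_plus1)+
next
  case (WhileFalse g s p)
  from WhileFalse.prems show ?case by (rule exec_WhileE) (metis WhileFalse.hyps One_nat_def)+
qed (erule exec_basicE, simp only: simp_thms)+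

fun code_length :: "program \<Rightarrow> nat" where
  "code_length (Seq p q) = code_length p + code_length q + 1"
| "code_length (Ite g p q) = code_length p + code_length q + 1"
| "code_length (While g p) = code_length p + 1"
| "code_length _ = 1"

text \<open>An algorithm for a sequence of testing problems on \<open>\<real>\<^bsup>N n\<^esup>\<close>, as the sequence of the
  \<open>{0,1}\<close>-valued functions that it computes.\<close>

definition zero_one_valued :: "(nat \<Rightarrow> nat) \<Rightarrow> (nat \<Rightarrow> (nat \<Rightarrow> real) \<Rightarrow> real) \<Rightarrow> bool" where
  "zero_one_valued N A \<longleftrightarrow>
     (\<forall>n. A n \<in> borel_measurable (Rn (N n)) \<and> (\<forall>y\<in>space (Rn (N n)). A n y \<in> {0, 1}))"

text \<open>Worst-case running time at most \<open>t n\<close> for all large \<open>n\<close>. The program may depend on \<open>n\<close>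
  (parameters of the \<open>n\<close>-th problem can be hard-wired), so its length is charged as part of the
  running time: otherwise exponentially large lookup tables would be free. A program that does not
  grow with \<open>n\<close> pays only a constant for this. The output is found in real register 0.\<close>

definition runs_in_time ::
    "(nat \<Rightarrow> nat) \<Rightarrow> (nat \<Rightarrow> (nat \<Rightarrow> real) \<Rightarrow> real) \<Rightarrow> (nat \<Rightarrow> real) \<Rightarrow> bool" where
  "runs_in_time N A t \<longleftrightarrow>
     (\<forall>\<^sub>F n in sequentially. \<exists>p. \<forall>y\<in>space (Rn (N n)). \<exists>k s.
        exec (map y [0..<N n]) p init_state k s \<and> rreg s 0 = A n y \<and>
        real (code_length p + k) \<le> t n)"

section \<open>Tests, detection and the low-degree heuristic\<close>

definition is_TCE_test ::
    "(nat \<Rightarrow> nat) \<Rightarrow> (nat \<Rightarrow> (nat \<Rightarrow> real) measure) \<Rightarrow> (nat \<Rightarrow> (nat \<Rightarrow> real) measure) \<Rightarrow>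
     (nat \<Rightarrow> real) \<Rightarrow> (nat \<Rightarrow> real) \<Rightarrow> (nat \<Rightarrow> real) \<Rightarrow> (nat \<Rightarrow> (nat \<Rightarrow> real) \<Rightarrow> real) \<Rightarrow> bool" where
  "is_TCE_test N P Q T c \<epsilon> A \<longleftrightarrow>
     zero_one_valued N A \<and>
     (\<exists>K>0. runs_in_time N A (\<lambda>n. K * real (N n) powr T n)) \<and>
     (\<forall>\<^sub>F n in sequentially.
        measure (P n) {y \<in> space (P n). A n y = 1} \<ge> c n \<and>
        measure (Q n) {y \<in> space (Q n). A n y = 1} \<le> \<epsilon> n)"

definition error_sum ::
    "(nat \<Rightarrow> (nat \<Rightarrow> real) measure) \<Rightarrow> (nat \<Rightarrow> (nat \<Rightarrow> real) measure) \<Rightarrow>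
     (nat \<Rightarrow> (nat \<Rightarrow> real) \<Rightarrow> real) \<Rightarrow> nat \<Rightarrow> real" where
  "error_sum P Q A n =
     measure (Q n) {y \<in> space (Q n). A n y = 1} + measure (P n) {y \<in> space (P n). A n y = 0}"

definition strong_detection ::
    "(nat \<Rightarrow> (nat \<Rightarrow> real) measure) \<Rightarrow> (nat \<Rightarrow> (nat \<Rightarrow> real) measure) \<Rightarrow>
     (nat \<Rightarrow> (nat \<Rightarrow> real) \<Rightarrow> real) \<Rightarrow> bool" where
  "strong_detection P Q A \<longleftrightarrow> error_sum P Q A \<longlonglongrightarrow> 0"

definition weak_detection ::
    "(nat \<Rightarrow> (nat \<Rightarrow> real) measure) \<Rightarrow> (nat \<Rightarrow> (nat \<Rightarrow> real) measure) \<Rightarrow>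
     (nat \<Rightarrow> (nat \<Rightarrow> real) \<Rightarrow> real) \<Rightarrow> bool" where
  "weak_detection P Q A \<longleftrightarrow> (\<exists>\<epsilon>>0. \<forall>\<^sub>F n in sequentially. error_sum P Q A n \<le> 1 - \<epsilon>)"

definition heuristic_time :: "(nat \<Rightarrow> nat) \<Rightarrow> (nat \<Rightarrow> nat) \<Rightarrow> real \<Rightarrow> nat \<Rightarrow> real" where
  "heuristic_time N D C n = real (N n) powr (real (D n) / (C * ln (real (N n))))"

definition low_degree_heuristic ::
    "(nat \<Rightarrow> nat) \<Rightarrow> (nat \<Rightarrow> nat) \<Rightarrow>
     (nat \<Rightarrow> (nat \<Rightarrow> real) measure) \<Rightarrow> (nat \<Rightarrow> (nat \<Rightarrow> real) measure) \<Rightarrow> bool" where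
  "low_degree_heuristic N D P Q \<longleftrightarrow>
     ((\<exists>B::real. \<forall>\<^sub>F n in sequentially. Adv (N n) (D n) (P n) (Q n) \<le> ereal B) \<longrightarrow>
      (\<exists>C>0. \<not> (\<exists>A. zero_one_valued N A \<and> runs_in_time N A (heuristic_time N D C) \<and>
                    strong_detection P Q A))) \<and>
     ((\<lambda>n. Adv (N n) (D n) (P n) (Q n)) \<longlonglongrightarrow> 1 \<longrightarrow>
      (\<exists>C>0. \<not> (\<exists>A. zero_one_valued N A \<and> runs_in_time N A (heuristic_time N D C) \<and>
                    weak_detection P Q A)))"

section \<open>The hidden informative sample problem\<close>

text \<open>The sample \<open>(Y\<^sub>0, \<dots>, Y\<^sub>M\<^sub>-\<^sub>1)\<close> of points of \<open>\<real>\<^sup>N\<close> is the point of \<open>\<real>\<^bsup>NM\<^esup>\<close> obtained by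
  concatenation.\<close>

definition flatten :: "nat \<Rightarrow> nat \<Rightarrow> (nat \<Rightarrow> nat \<Rightarrow> real) \<Rightarrow> nat \<Rightarrow> real" where
  "flatten N M Y = (\<lambda>k\<in>{..<N * M}. Y (k div N) (k mod N))"

definition hidden_null :: "nat \<Rightarrow> nat \<Rightarrow> (nat \<Rightarrow> real) measure \<Rightarrow> (nat \<Rightarrow> real) measure" where
  "hidden_null N M Q = distr (PiM {..<M} (\<lambda>_. Q)) (Rn (N * M)) (flatten N M)"

definition hidden_planted ::
    "nat \<Rightarrow> nat \<Rightarrow> (nat \<Rightarrow> real) measure \<Rightarrow> (nat \<Rightarrow> real) measure \<Rightarrow> (nat \<Rightarrow> real) measure" where
  "hidden_planted N M P Q =
     measure_pmf (pmf_of_set {..<M}) \<bind>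
       (\<lambda>\<kappa>. distr (PiM {..<M} (\<lambda>j. if j = \<kappa> then P else Q)) (Rn (N * M)) (flatten N M))"

end

theory Submission imports Defs begin

text \<open>Given a test of level \<open>\<epsilon>\<close>, run it on all \<open>M\<close> samples of the hidden informative sample problem and
  report whether one of the runs rejects. The level becomes at most \<open>M\<epsilon> = o(1)\<close> and the power does not
  drop, so this detects weakly, in time of order \<open>M N\<^sup>T \<le> \<Delta> N\<^bsup>T+1\<^esup>\<close>. On the other hand, projecting a
  polynomial of the \<open>M\<close> samples onto the constants and the centred functions of a single sample
  (Bessel's inequality) shows that the squared advantage of the hidden problem is at most
  \<open>1 + \<Delta> / M = 1 + o(1)\<close>, so the heuristic forbids weak detection. The constant does not depend on \<open>\<epsilon>\<close>:
  if there were a counterexample for each \<open>C = 1, 2, \<dots>\<close>, a single null sequence would dominate all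
  the levels \<open>\<epsilon>\<^sub>k \<Delta>\<close>, and one choice of \<open>M\<close> would serve all of them.\<close>

section \<open>Running a program on every sample\<close>

text \<open>Under the alternative a single sample deviates from \<open>Q\<close>, so the planted
  mean of a polynomial \<open>F\<close> of all samples sees \<open>F\<close> only through its
  conditional expectations given one sample. These are again polynomials of degree at most
  \<open>D\<close>, so the advantage of the original problem bounds their means under
  \<open>P\<close>; the argument works with moments, without a density of \<open>P\<close> with
  respect to \<open>Q\<close>. Centring matters: the constant part then enters with factor 1, and
  only the mutually orthogonal centred parts carry the factor \<open>sqrt \<Delta>\<close>, which
  averaging over the \<open>M\<close> positions turns into \<open>sqrt (\<Delta> / M)\<close>. A
  power that is merely bounded below contradicts only the impossibility of weak detection, so the
  advantage must tend to 1 and not just stay bounded; this is why \<open>M\<close> has to outgrow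
  \<Delta>. The logical obstacle is the order of choices: the heuristic supplies its constant after
  \<open>M\<close>, and \<open>M\<close> after the level, whereas the constant of the theorem must
  precede the level.\<close>

text \<open>Copy \<open>j\<close> of a program gets its own registers and arrays, so that nothing has to be reset between
  the runs; real register 0 holds the common output, real register 1 stays zero, and index register 0
  is scratch space for the address of an input.\<close>

definition reg :: "nat \<Rightarrow> nat \<Rightarrow> nat" where
  "reg j r = Suc (Suc (prod_encode (j, r)))"

lemma reg_eq_iff [simp]: "reg i r = reg j r' \<longleftrightarrow> i = j \<and> r = r'"
  by (simp add: reg_def)

lemma reg_neq [simp]:
  "reg j r \<noteq> 0" "reg j r \<noteq> Suc 0" "0 \<noteq> reg j r" "Suc 0 \<noteq> reg j r"
  by (simp_all add: reg_def)

fun relocate_guard :: "nat \<Rightarrow> guard \<Rightarrow> guard" where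
  "relocate_guard j (RLess r r') = RLess (reg j r) (reg j r')"
| "relocate_guard j (ILess i i') = ILess (reg j i) (reg j i')"

text \<open>\<open>d\<close> is the position at which the data of copy \<open>j\<close> begin in the
  concatenated input. Only \<open>Input\<close> has to be expanded: its replacement takes 3 steps
  and has code length 5, which is the origin of the factors 3 and 5 in the cost bounds.\<close>

fun relocate :: "nat \<Rightarrow> nat \<Rightarrow> program \<Rightarrow> program" where
  "relocate j d Skip = Skip"
| "relocate j d (RConst r x) = RConst (reg j r) x"
| "relocate j d (ROp f r r1 r2) = ROp f (reg j r) (reg j r1) (reg j r2)"
| "relocate j d (IConst i m) = IConst (reg j i) m"
| "relocate j d (IOp f i i1 i2) = IOp f (reg j i) (reg j i1) (reg j i2)"
| "relocate j d (Input r i) =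
     Seq (IConst 0 d) (Seq (IOp IAdd 0 0 (reg j i)) (Input (reg j r) 0))"
| "relocate j d (Load r a i) = Load (reg j r) (reg j a) (reg j i)"
| "relocate j d (Store a i r) = Store (reg j a) (reg j i) (reg j r)"
| "relocate j d (Seq p q) = Seq (relocate j d p) (relocate j d q)"
| "relocate j d (Ite g p q) = Ite (relocate_guard j g) (relocate j d p) (relocate j d q)"
| "relocate j d (While g p) = While (relocate_guard j g) (relocate j d p)"

text \<open>The simulation relation. It leaves everything outside copy \<open>j\<close> free, in
  particular the scratch register. Array names are relocated, positions inside an array are
  not.\<close>

definition embeds :: "nat \<Rightarrow> state \<Rightarrow> state \<Rightarrow> bool" where
  "embeds j s S \<longleftrightarrow>
     (\<forall>r. rreg S (reg j r) = rreg s r) \<and> (\<forall>i. ireg S (reg j i) = ireg s i) \<and>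
     (\<forall>a. arr S (reg j a) = arr s a)"

text \<open>The frame condition of a run of copy \<open>j\<close>. Quantifying over all
  \<open>t\<close> expresses that the part of the state owned by any other copy is unchanged; this
  keeps the later copies in their initial state.\<close>

definition preserves :: "nat \<Rightarrow> state \<Rightarrow> state \<Rightarrow> bool" where
  "preserves j S S' \<longleftrightarrow>
     (\<forall>i t. i \<noteq> j \<longrightarrow> embeds i t S \<longrightarrow> embeds i t S') \<and> rreg S' 0 = rreg S 0 \<and> rreg S' 1 = rreg S 1"

lemma preserves_refl [simp]: "preserves j S S"
  by (simp add: preserves_def)

lemma preserves_trans: "preserves j S S' \<Longrightarrow> preserves j S' S'' \<Longrightarrow> preserves j S S''"
  by (auto simp: preserves_def)

lemma relocate_guard_val: "embeds j s S \<Longrightarrow> guard_val (relocate_guard j g) S = guard_val g s"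
  by (cases g) (auto simp: embeds_def)

lemma code_length_pos: "1 \<le> code_length p"
  by (induction p) auto

lemma code_length_relocate: "code_length (relocate j d p) \<le> 5 * code_length p"
  by (induction p) auto

text \<open>A simulation by induction on the execution. The source run never reads outside
  \<open>xs\<close>, so \<open>inp\<close> has to match the two inputs only on the window of length
  \<open>length xs\<close> that starts at \<open>d\<close>.\<close>

lemma exec_relocate:
  assumes "exec xs p s k s'" and "embeds j s S"
    and inp: "\<And>i. i < length xs \<Longrightarrow> d + i < length zs \<and> zs ! (d + i) = xs ! i"
  shows "\<exists>k' S'. exec zs (relocate j d p) S k' S' \<and> k' \<le> 3 * k \<and> embeds j s' S' \<and> preserves j S S'"
  using assms(1,2)
proof (induction arbitrary: S rule: exec.induct)
  case (Skip s)
  show ?case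
    by (rule exI, rule exI, intro conjI, simp only: relocate.simps, rule exec.Skip)
      (use Skip in auto)
next
  case (RConst r x s)
  show ?case
    by (rule exI, rule exI, intro conjI, simp only: relocate.simps, rule exec.RConst)
      (use RConst in \<open>auto simp: embeds_def preserves_def\<close>)
next
  case (ROp f r r1 r2 s)
  show ?case
    by (rule exI, rule exI, intro conjI, simp only: relocate.simps, rule exec.ROp)
      (use ROp in \<open>auto simp: embeds_def preserves_def\<close>)
next
  case (IConst i m s)
  show ?case
    by (rule exI, rule exI, intro conjI, simp only: relocate.simps, rule exec.IConst)
      (use IConst in \<open>auto simp: embeds_def preserves_def\<close>)
next
  case (IOp f i i1 i2 s)
  show ?case
    by (rule exI, rule exI, intro conjI, simp only: relocate.simps, rule exec.IOp)
      (use IOp in \<open>auto simp: embeds_def preserves_def\<close>)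
next
  case (Input s i r)
  let ?S1 = "S\<lparr>ireg := (ireg S)(0 := d)\<rparr>"
  let ?S2 = "?S1\<lparr>ireg := (ireg ?S1)(0 := index_op_val IAdd (ireg ?S1 0) (ireg ?S1 (reg j i)))\<rparr>"
  let ?S3 = "?S2\<lparr>rreg := (rreg ?S2)(reg j r := zs ! ireg ?S2 0)\<rparr>"
  have i: "ireg ?S2 0 = d + ireg s i"
    using Input.prems by (simp add: embeds_def)
  have "exec zs (relocate j d (Input r i)) S (1 + (1 + 1)) ?S3"
    unfolding relocate.simps
    by (intro exec.Seq, rule exec.IConst, rule exec.IOp, rule exec.Input)
      (use inp[OF Input.hyps] i in simp)
  moreover have "embeds j (s\<lparr>rreg := (rreg s)(r := xs ! ireg s i)\<rparr>) ?S3"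
    using Input.prems inp[OF Input.hyps] by (auto simp: embeds_def)
  moreover have "preserves j S ?S3"
    by (auto simp: embeds_def preserves_def)
  ultimately show ?case
    by (intro exI conjI) auto
next
  case (Load r a i s)
  show ?case
    by (rule exI, rule exI, intro conjI, simp only: relocate.simps, rule exec.Load)
      (use Load in \<open>auto simp: embeds_def preserves_def\<close>)
next
  case (Store a i r s)
  show ?case
    by (rule exI, rule exI, intro conjI, simp only: relocate.simps, rule exec.Store)
      (use Store in \<open>auto simp: embeds_def preserves_def\<close>)
next
  case (Seq p s k s' q k' s'')
  obtain k1 S1 where 1: "exec zs (relocate j d p) S k1 S1" "k1 \<le> 3 * k" "embeds j s' S1"
      "preserves j S S1"
    using Seq.IH(1)[OF Seq.prems] by blast
  obtain k2 S2 where 2: "exec zs (relocate j d q) S1 k2 S2" "k2 \<le> 3 * k'" "embeds j s'' S2"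
      "preserves j S1 S2"
    using Seq.IH(2)[OF 1(3)] by blast
  show ?case
    using exec.Seq[OF 1(1) 2(1)] 1 2 preserves_trans[OF 1(4) 2(4)]
    by (intro exI[of _ "k1 + k2"] exI[of _ S2]) auto
next
  case (IteTrue g s p k s' q)
  obtain k1 S1 where 1: "exec zs (relocate j d p) S k1 S1" "k1 \<le> 3 * k" "embeds j s' S1"
      "preserves j S S1"
    using IteTrue.IH[OF IteTrue.prems] by blast
  have "guard_val (relocate_guard j g) S"
    using IteTrue relocate_guard_val by blast
  from exec.IteTrue[OF this 1(1)] 1 show ?case
    by (intro exI[of _ "k1 + 1"] exI[of _ S1]) auto
next
  case (IteFalse g s q k s' p)
  obtain k1 S1 where 1: "exec zs (relocate j d q) S k1 S1" "k1 \<le> 3 * k" "embeds j s' S1"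
      "preserves j S S1"
    using IteFalse.IH[OF IteFalse.prems] by blast
  have "\<not> guard_val (relocate_guard j g) S"
    using IteFalse relocate_guard_val by blast
  from exec.IteFalse[OF this 1(1)] 1 show ?case
    by (intro exI[of _ "k1 + 1"] exI[of _ S1]) auto
next
  case (WhileFalse g s p)
  have "\<not> guard_val (relocate_guard j g) S"
    using WhileFalse relocate_guard_val by blast
  from exec.WhileFalse[OF this] WhileFalse show ?case
    by (intro exI[of _ 1] exI[of _ S]) auto
next
  case (WhileTrue g s p k s' k' s'')
  obtain k1 S1 where 1: "exec zs (relocate j d p) S k1 S1" "k1 \<le> 3 * k" "embeds j s' S1"
      "preserves j S S1"
    using WhileTrue.IH(1)[OF WhileTrue.prems] by blast
  obtain k2 S2 where 2: "exec zs (relocate j d (While g p)) S1 k2 S2" "k2 \<le> 3 * k'"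
      "embeds j s'' S2" "preserves j S1 S2"
    using WhileTrue.IH(2)[OF 1(3)] by blast
  have "guard_val (relocate_guard j g) S"
    using WhileTrue relocate_guard_val by blast
  from exec.WhileTrue[OF this 1(1) 2(1)[unfolded relocate.simps]] 1 2 preserves_trans[OF 1(4) 2(4)]
  show ?case
    by (intro exI[of _ "k1 + k2 + 1"] exI[of _ S2]) auto
qed

text \<open>The loop over the samples is unrolled because register names are constants of the
  program text and each copy needs its own. Real register 1 always holds 0, so the guard asks
  whether the output of copy \<open>m\<close> is positive, which singles out the output 1.\<close>

fun scan :: "nat \<Rightarrow> program \<Rightarrow> nat \<Rightarrow> program" where
  "scan N p 0 = Skip"
| "scan N p (Suc m) =
     Seq (scan N p m) (Seq (relocate m (m * N) p) (Ite (RLess 1 (reg m 0)) (RConst 0 1) Skip))"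

lemma code_length_scan: "code_length (scan N p m) \<le> 1 + m * (5 * code_length p + 5)"
proof (induction m)
  case (Suc m)
  then show ?case using code_length_relocate[of m "m * N" p] by simp
qed simp

definition block :: "nat \<Rightarrow> nat \<Rightarrow> (nat \<Rightarrow> real) \<Rightarrow> nat \<Rightarrow> real" where
  "block N j z = (\<lambda>i\<in>{..<N}. z (j * N + i))"

lemma block_offset_less:
  assumes "j < M" and "i < N"
  shows "j * N + i < N * (M::nat)"
proof -
  have "j * N + i < Suc j * N" using assms by simp
  also have "\<dots> \<le> M * N" using assms by (intro mult_le_mono1) simp
  finally show ?thesis by (simp add: mult.commute)
qed

text \<open>The invariants for the induction are that the copies from \<open>m\<close> on are
  untouched and that register 1 is still 0. In the time bound, 1 pays for \<open>Skip\<close>; each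
  sample costs at most \<open>3 * t\<close> for the relocated run and 2 for the conditional.\<close>

lemma exec_scan:
  assumes "\<And>j. j < M \<Longrightarrow>
      exec (map (block N j z) [0..<N]) p init_state (k j) (s j) \<and> k j \<le> t"
    and "m \<le> M"
  shows "\<exists>K S. exec (map z [0..<N * M]) (scan N p m) init_state K S \<and> K \<le> 1 + m * (3 * t + 2) \<and>
      rreg S 1 = 0 \<and> (\<forall>i\<ge>m. embeds i init_state S) \<and>
      rreg S 0 = (if \<exists>j<m. 0 < rreg (s j) 0 then 1 else 0)"
  using assms(2)
proof (induction m)
  case 0
  show ?case
    by (rule exI[of _ 1], rule exI[of _ init_state])
      (use exec.Skip in \<open>auto simp: init_state_def embeds_def\<close>)
next
  case (Suc m)
  then obtain K S where S: "exec (map z [0..<N * M]) (scan N p m) init_state K S"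
      "K \<le> 1 + m * (3 * t + 2)" "rreg S 1 = 0" "\<And>i. i \<ge> m \<Longrightarrow> embeds i init_state S"
      "rreg S 0 = (if \<exists>j<m. 0 < rreg (s j) 0 then 1 else 0)"
    by auto
  have m: "m < M" using Suc.prems by simp
  have "\<exists>k' S'. exec (map z [0..<N * M]) (relocate m (m * N) p) S k' S' \<and> k' \<le> 3 * k m \<and>
      embeds m (s m) S' \<and> preserves m S S'"
  proof (rule exec_relocate[of "map (block N m z) [0..<N]"])
    fix i assume "i < length (map (block N m z) [0..<N])"
    then show "m * N + i < length (map z [0..<N * M]) \<and>
        map z [0..<N * M] ! (m * N + i) = map (block N m z) [0..<N] ! i"
      using block_offset_less[OF m, of i N] by (simp add: block_def)
  qed (use assms(1)[OF m] S(4) in auto)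
  then obtain k' S' where S': "exec (map z [0..<N * M]) (relocate m (m * N) p) S k' S'"
      "k' \<le> 3 * k m" "embeds m (s m) S'" "preserves m S S'"
    by blast
  have pres: "rreg S' 0 = rreg S 0" "rreg S' 1 = 0" "\<And>i. i > m \<Longrightarrow> embeds i init_state S'"
    using S'(4) S(3,4) by (auto simp: preserves_def)
  have res: "rreg S' (reg m 0) = rreg (s m) 0"
    using S'(3) by (simp add: embeds_def)
  have k': "k' \<le> 3 * t" using S'(2) assms(1)[OF m] by simp
  show ?case
  proof (cases "0 < rreg (s m) 0")
    case True
    let ?S = "S'\<lparr>rreg := (rreg S')(0 := 1)\<rparr>"
    have "guard_val (RLess 1 (reg m 0)) S'" using True res pres by simp
    note e = exec.Seq[OF S(1) exec.Seq[OF S'(1)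
          exec.IteTrue[OF this exec.RConst[of _ 0 1], where q = Skip]]]
    have "\<exists>j<Suc m. 0 < rreg (s j) 0" using True by auto
    then have "rreg ?S 0 = (if \<exists>j<Suc m. 0 < rreg (s j) 0 then 1 else 0)" by simp
    moreover have "\<forall>i\<ge>Suc m. embeds i init_state ?S"
      using pres(3) by (auto simp: embeds_def)
    ultimately show ?thesis
      by (intro exI[of _ "K + (k' + (1 + 1))"] exI[of _ ?S] conjI)
        (use e S(2) k' pres in \<open>auto simp: algebra_simps\<close>)
  next
    case False
    then have "\<not> guard_val (RLess 1 (reg m 0)) S'" using res pres by simp
    note e = exec.Seq[OF S(1) exec.Seq[OF S'(1) exec.IteFalse[OF this exec.Skip,
          where p = "RConst 0 1"]]]
    have "rreg S' 0 = (if \<exists>j<Suc m. 0 < rreg (s j) 0 then 1 else 0)"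
      using False pres(1) S(5) by (auto simp: less_Suc_eq)
    moreover have "\<forall>i\<ge>Suc m. embeds i init_state S'"
      using pres(3) by auto
    ultimately show ?thesis
      by (intro exI[of _ "K + (k' + (1 + 1))"] exI[of _ S'] conjI)
        (use e S(2) k' pres in \<open>auto simp: algebra_simps\<close>)
  qed
qed

definition any_block :: "nat \<Rightarrow> nat \<Rightarrow> ((nat \<Rightarrow> real) \<Rightarrow> real) \<Rightarrow> (nat \<Rightarrow> real) \<Rightarrow> real" where
  "any_block N M A z = (if \<exists>j<M. A (block N j z) = 1 then 1 else 0)"

lemma block_in_space: "block N j z \<in> space (Rn N)"
  by (auto simp: Rn_def space_PiM block_def)

text \<open>Length and running time of the combined program add up to at most
  \<open>2 + M * (8 * u + 7)\<close>, where \<open>u\<close> bounds the cost of one run. Since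
  \<open>M\<close> and \<open>u\<close> are at least 1, this is at most
  \<open>M * (8 * u + 9)\<close> and hence at most \<open>17 * M * u\<close>.\<close>

lemma scan_computes_any_block:
  assumes p: "\<And>y. y \<in> space (Rn N) \<Longrightarrow> \<exists>k s. exec (map y [0..<N]) p init_state k s \<and>
        rreg s 0 = A y \<and> real (code_length p + k) \<le> t"
    and A: "\<And>y. y \<in> space (Rn N) \<Longrightarrow> A y \<in> {0, 1}" and M: "0 < M"
  shows "\<exists>k s. exec (map z [0..<N * M]) (scan N p M) init_state k s \<and>
      rreg s 0 = any_block N M A z \<and> real (code_length (scan N p M) + k) \<le> 17 * (real M * t)"
proof -
  have "\<forall>j. \<exists>k s. exec (map (block N j z) [0..<N]) p init_state k s \<and>
      rreg s 0 = A (block N j z) \<and> real (code_length p + k) \<le> t"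
    using p[OF block_in_space] by blast
  then obtain k s where ks: "\<And>j. exec (map (block N j z) [0..<N]) p init_state (k j) (s j)"
      "\<And>j. rreg (s j) 0 = A (block N j z)" "\<And>j. real (code_length p + k j) \<le> t"
    by metis
  \<comment> \<open>Rounding down loses nothing, because costs are integers, and it allows the
    estimate to be carried out in the natural numbers.\<close>
  define u where "u = nat \<lfloor>t\<rfloor>"
  have u: "code_length p + k j \<le> u" for j
    using ks(3)[of j] unfolding u_def by (simp add: le_nat_floor)
  have ut: "real u \<le> t"
    using ks(3)[of 0] unfolding u_def by (simp add: of_nat_floor)
  have "\<exists>K S. exec (map z [0..<N * M]) (scan N p M) init_state K S \<and> K \<le> 1 + M * (3 * u + 2) \<and>
      rreg S 1 = 0 \<and> (\<forall>i\<ge>M. embeds i init_state S) \<and>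
      rreg S 0 = (if \<exists>j<M. 0 < rreg (s j) 0 then 1 else 0)"
    by (rule exec_scan[where k = k]) (use ks(1) u in \<open>auto intro: add_leD2\<close>)
  then obtain K S where S: "exec (map z [0..<N * M]) (scan N p M) init_state K S"
      "K \<le> 1 + M * (3 * u + 2)" "rreg S 0 = (if \<exists>j<M. 0 < rreg (s j) 0 then 1 else 0)"
    by blast
  have "0 < rreg (s j) 0 \<longleftrightarrow> A (block N j z) = 1" for j
    using A[OF block_in_space[of N j z]] ks(2)[of j] by auto
  then have out: "rreg S 0 = any_block N M A z"
    using S(3) by (simp add: any_block_def)
  have "code_length (scan N p M) + K \<le> 2 + M * (5 * code_length p + 5 + (3 * u + 2))"
    using code_length_scan[of N p M] S(2) by (simp add: algebra_simps)
  also have "\<dots> \<le> M * 2 + M * (5 * u + 5 + (3 * u + 2))"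
    using M u[of 0] by (intro add_mono mult_mono) auto
  also have "\<dots> = M * (8 * u + 9)" by (simp add: algebra_simps)
  \<comment> \<open>Every program has positive length, so \<open>u\<close> is at least 1 and 9 is
    absorbed by \<open>9 * u\<close>.\<close>
  also have "\<dots> \<le> M * (17 * u)"
    using u[of 0] code_length_pos[of p] by (intro mult_mono) auto
  finally have "real (code_length (scan N p M) + K) \<le> real (M * (17 * u))" by linarith
  also have "\<dots> \<le> 17 * (real M * t)"
    using mult_left_mono[OF ut, of "real M"] by (simp add: mult.commute)
  finally show ?thesis using S(1) out by blast
qed

section \<open>Projection onto functions of a single sample\<close>

definition square_integrable :: "'a measure \<Rightarrow> ('a \<Rightarrow> real) \<Rightarrow> bool" where
  "square_integrable M f \<longleftrightarrow> f \<in> borel_measurable M \<and> integrable M (\<lambda>x. (f x)\<^sup>2)"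

lemma integrable_mult_square_integrable:
  assumes "square_integrable M f" and "square_integrable M g"
  shows "integrable M (\<lambda>x. f x * g x)"
proof (rule Bochner_Integration.integrable_bound)
  show "integrable M (\<lambda>x. (f x)\<^sup>2 + (g x)\<^sup>2)"
    using assms by (auto simp: square_integrable_def)
  show "(\<lambda>x. f x * g x) \<in> borel_measurable M"
    using assms by (auto simp: square_integrable_def)
  have "norm (f x * g x) \<le> norm ((f x)\<^sup>2 + (g x)\<^sup>2)" for x
  proof -
    have "2 * (\<bar>f x\<bar> * \<bar>g x\<bar>) \<le> (f x)\<^sup>2 + (g x)\<^sup>2"
      using sum_squares_bound[of "\<bar>f x\<bar>" "\<bar>g x\<bar>"] by simp
    moreover have "0 \<le> \<bar>f x\<bar> * \<bar>g x\<bar>" by simp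
    ultimately have "\<bar>f x\<bar> * \<bar>g x\<bar> \<le> (f x)\<^sup>2 + (g x)\<^sup>2" by linarith
    then show ?thesis by (simp add: abs_mult)
  qed
  then show "AE x in M. norm (f x * g x) \<le> norm ((f x)\<^sup>2 + (g x)\<^sup>2)" by simp
qed

lemma square_integrable_const [simp]:
  assumes "prob_space M"
  shows "square_integrable M (\<lambda>x. c)"
proof -
  interpret prob_space M by fact
  show ?thesis by (simp add: square_integrable_def)
qed

lemma square_integrable_imp_integrable:
  assumes "prob_space M" and "square_integrable M f"
  shows "integrable M f"
  using integrable_mult_square_integrable[OF assms(2) square_integrable_const[OF assms(1), of 1]]
  by simp

lemma square_integrable_cmult:
  assumes "square_integrable M f"
  shows "square_integrable M (\<lambda>x. c * f x)"
  using assms by (auto simp: square_integrable_def power_mult_distrib)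

lemma square_integrable_add:
  assumes "square_integrable M f" and "square_integrable M g"
  shows "square_integrable M (\<lambda>x. f x + g x)"
proof -
  have "integrable M (\<lambda>x. (f x)\<^sup>2 + (g x)\<^sup>2 + 2 * (f x * g x))"
    using assms integrable_mult_square_integrable[OF assms] by (auto simp: square_integrable_def)
  then show ?thesis
    using assms by (auto simp: square_integrable_def power2_sum algebra_simps)
qed

lemma square_integrable_sum:
  assumes "prob_space M" and "\<And>i. i \<in> I \<Longrightarrow> square_integrable M (f i)"
  shows "square_integrable M (\<lambda>x. \<Sum>i\<in>I. f i x)"
  using assms(2)
  by (induction I rule: infinite_finite_induct) (auto intro: square_integrable_add simp: assms(1))

text \<open>The equation \<open>eq\<close> says that \<open>F - G\<close> is orthogonal to
  \<open>G\<close>, and expanding the square of \<open>F - G\<close> then gives the claim. Bessel's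
  inequality will follow by checking \<open>eq\<close> for an explicit \<open>G\<close>.\<close>

lemma integral_square_projection_le:
  assumes F: "square_integrable M F" and G: "square_integrable M G"
    and eq: "(\<integral>x. F x * G x \<partial>M) = (\<integral>x. (G x)\<^sup>2 \<partial>M)"
  shows "(\<integral>x. (G x)\<^sup>2 \<partial>M) \<le> (\<integral>x. (F x)\<^sup>2 \<partial>M)"
proof -
  have "0 \<le> (\<integral>x. (F x - G x)\<^sup>2 \<partial>M)" by simp
  also have "\<dots> = (\<integral>x. (F x)\<^sup>2 + (G x)\<^sup>2 - 2 * (F x * G x) \<partial>M)"
    by (simp add: power2_diff algebra_simps)
  also have "\<dots> = (\<integral>x. (F x)\<^sup>2 \<partial>M) + (\<integral>x. (G x)\<^sup>2 \<partial>M) - 2 * (\<integral>x. F x * G x \<partial>M)"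
    using F G integrable_mult_square_integrable[OF F G] by (simp add: square_integrable_def)
  finally show ?thesis using eq by simp
qed

section \<open>Integrals of products over independent samples\<close>

lemma product_sigma_finite_prob: "(\<And>j. prob_space (R j)) \<Longrightarrow> product_sigma_finite R"
  by (intro product_sigma_finite.intro prob_space_imp_sigma_finite)

lemma square_integrable_prod:
  fixes M :: nat
  assumes Q: "prob_space Q" and u: "\<And>j. j < M \<Longrightarrow> square_integrable Q (u j)"
  shows "square_integrable (PiM {..<M} (\<lambda>_. Q)) (\<lambda>Y. \<Prod>j<M. u j (Y j))"
proof -
  interpret product_sigma_finite "\<lambda>_. Q"
    using Q by (rule product_sigma_finite_prob)
  have "integrable (PiM {..<M} (\<lambda>_. Q)) (\<lambda>Y. \<Prod>j<M. (\<lambda>y. (u j y)\<^sup>2) (Y j))"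
    using u by (intro product_integrable_prod) (auto simp: square_integrable_def)
  moreover have "(\<lambda>Y. \<Prod>j<M. u j (Y j)) \<in> borel_measurable (PiM {..<M} (\<lambda>_. Q))"
    using u by (intro borel_measurable_prod measurable_compose[OF measurable_component_singleton])
      (auto simp: square_integrable_def)
  ultimately show ?thesis
    by (simp add: square_integrable_def prod_power_distrib)
qed

lemma square_integrable_component:
  fixes M :: nat
  assumes Q: "prob_space Q" and h: "square_integrable Q h" and k: "k < M"
  shows "square_integrable (PiM {..<M} (\<lambda>_. Q)) (\<lambda>Y. h (Y k))"
proof -
  have "square_integrable (PiM {..<M} (\<lambda>_. Q)) (\<lambda>Y. \<Prod>j<M. (if j = k then h else (\<lambda>_. 1)) (Y j))"
    using h Q by (intro square_integrable_prod) auto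
  moreover have "(\<Prod>j<M. (if j = k then h else (\<lambda>_. 1)) (Y j)) = h (Y k)" for Y :: "nat \<Rightarrow> 'a"
    using k by (simp add: if_distribR prod.delta)
  ultimately show ?thesis by simp
qed

text \<open>Absorb \<open>h\<close> into factor \<open>k\<close> and apply Fubini. Read for all
  \<open>h\<close>, this identifies the conditional expectation of the product given sample
  \<open>k\<close>: the other factors are replaced by their means under \<open>Q\<close>.\<close>

lemma integral_prod_mult_component:
  fixes M :: nat
  assumes Q: "prob_space Q" and u: "\<And>j. j < M \<Longrightarrow> square_integrable Q (u j)"
    and h: "square_integrable Q h" and k: "k < M"
  shows "(\<integral>Y. (\<Prod>j<M. u j (Y j)) * h (Y k) \<partial>PiM {..<M} (\<lambda>_. Q)) =
    (\<integral>y. u k y * h y \<partial>Q) * (\<Prod>j\<in>{..<M} - {k}. \<integral>y. u j y \<partial>Q)"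
proof -
  interpret product_sigma_finite "\<lambda>_. Q"
    using Q by (rule product_sigma_finite_prob)
  let ?v = "\<lambda>j y. if j = k then u j y * h y else u j y"
  have "(\<Prod>j<M. u j (Y j)) * h (Y k) = (\<Prod>j<M. ?v j (Y j))" for Y
  proof -
    have "(\<Prod>j<M. ?v j (Y j)) = ?v k (Y k) * (\<Prod>j\<in>{..<M} - {k}. ?v j (Y j))"
      using k by (intro prod.remove) auto
    also have "\<dots> = (u k (Y k) * (\<Prod>j\<in>{..<M} - {k}. u j (Y j))) * h (Y k)"
      by simp
    also have "u k (Y k) * (\<Prod>j\<in>{..<M} - {k}. u j (Y j)) = (\<Prod>j<M. u j (Y j))"
      using k by (intro prod.remove[symmetric]) auto
    finally show ?thesis by simp
  qed
  then have "(\<integral>Y. (\<Prod>j<M. u j (Y j)) * h (Y k) \<partial>PiM {..<M} (\<lambda>_. Q)) =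
      (\<integral>Y. (\<Prod>j<M. ?v j (Y j)) \<partial>PiM {..<M} (\<lambda>_. Q))"
    by simp
  also have "\<dots> = (\<Prod>j<M. \<integral>y. ?v j y \<partial>Q)"
  proof (rule product_integral_prod)
    fix j assume "j \<in> {..<M}"
    then show "integrable Q (?v j)"
      using u h Q by (cases "j = k")
        (auto intro: integrable_mult_square_integrable square_integrable_imp_integrable)
  qed simp
  also have "\<dots> = (\<integral>y. ?v k y \<partial>Q) * (\<Prod>j\<in>{..<M} - {k}. \<integral>y. ?v j y \<partial>Q)"
    using k by (intro prod.remove) auto
  finally show ?thesis by simp
qed

text \<open>The constant multiplying the integral of \<open>u k\<close> is the same as in
  \<open>integral_prod_mult_component\<close>. Hence the planted mean of a product is the mean under
  \<open>P\<close> of its conditional expectation under the null law.\<close>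

lemma integral_prod_planted:
  fixes M :: nat and u :: "nat \<Rightarrow> 'a \<Rightarrow> real"
  assumes P: "prob_space P" and Q: "prob_space Q" and k: "k < M"
    and u: "\<And>j. j < M \<Longrightarrow> integrable Q (u j)" and uP: "integrable P (u k)"
  shows "integrable (PiM {..<M} (\<lambda>j. if j = k then P else Q)) (\<lambda>Y. \<Prod>j<M. u j (Y j))"
    and "(\<integral>Y. (\<Prod>j<M. u j (Y j)) \<partial>PiM {..<M} (\<lambda>j. if j = k then P else Q)) =
    (\<integral>y. u k y \<partial>P) * (\<Prod>j\<in>{..<M} - {k}. \<integral>y. u j y \<partial>Q)"
proof -
  interpret product_sigma_finite "\<lambda>j. if j = k then P else Q"
    using P Q by (intro product_sigma_finite_prob) auto
  show "integrable (PiM {..<M} (\<lambda>j. if j = k then P else Q)) (\<lambda>Y. \<Prod>j<M. u j (Y j))"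
    using u uP by (intro product_integrable_prod[of "{..<M}" u]) auto
  have "(\<integral>Y. (\<Prod>j<M. u j (Y j)) \<partial>PiM {..<M} (\<lambda>j. if j = k then P else Q)) =
      (\<Prod>j<M. \<integral>y. u j y \<partial>(if j = k then P else Q))"
    using u uP by (intro product_integral_prod[of "{..<M}" u]) auto
  also have "\<dots> = (\<integral>y. u k y \<partial>(if k = k then P else Q)) *
      (\<Prod>j\<in>{..<M} - {k}. \<integral>y. u j y \<partial>(if j = k then P else Q))"
    using k by (intro prod.remove) auto
  also have "\<dots> = (\<integral>y. u k y \<partial>P) * (\<Prod>j\<in>{..<M} - {k}. \<integral>y. u j y \<partial>Q)"
    by simp
  finally show "(\<integral>Y. (\<Prod>j<M. u j (Y j)) \<partial>PiM {..<M} (\<lambda>j. if j = k then P else Q)) =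
    (\<integral>y. u k y \<partial>P) * (\<Prod>j\<in>{..<M} - {k}. \<integral>y. u j y \<partial>Q)" .
qed

text \<open>Here \<open>x k\<close> stands for the norm of the centred function of sample
  \<open>k\<close>. The mean \<open>X\<close> satisfies \<open>real M * X\<^sup>2 \<le> S\<close> by
  nonnegativity of the variance; what remains is Cauchy-Schwarz in the plane for the vectors
  \<open>(1, s / sqrt M)\<close> and \<open>(\<mu>, sqrt M * X)\<close>.\<close>

lemma planted_cauchy_schwarz:
  fixes x :: "nat \<Rightarrow> real"
  assumes "0 < M" and "0 \<le> s"
  shows "(\<Sum>k<M. \<mu> + s * x k) / real M \<le>
    sqrt (1 + s\<^sup>2 / real M) * sqrt (\<mu>\<^sup>2 + (\<Sum>k<M. (x k)\<^sup>2))"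
proof -
  define X where "X = (\<Sum>k<M. x k) / real M"
  define S where "S = (\<Sum>k<M. (x k)\<^sup>2)"
  have "0 \<le> (\<Sum>k<M. (x k - X)\<^sup>2)" by (intro sum_nonneg) auto
  also have "\<dots> = S - 2 * X * (\<Sum>k<M. x k) + real M * X\<^sup>2"
    by (simp add: S_def power2_diff sum.distrib sum_subtractf sum_distrib_left algebra_simps)
  also have "\<dots> = S - real M * X\<^sup>2"
    using assms by (simp add: X_def power2_eq_square)
  finally have X: "real M * X\<^sup>2 \<le> S" by simp
  have "(\<Sum>k<M. \<mu> + s * x k) / real M = \<mu> + s * X"
    using assms by (simp add: X_def sum.distrib sum_distrib_left[symmetric] add_divide_distrib)
  moreover have "(\<mu> + s * X)\<^sup>2 \<le> (1 + s\<^sup>2 / real M) * (\<mu>\<^sup>2 + real M * X\<^sup>2)"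
  proof -
    \<comment> \<open>Lagrange's identity for these two vectors: the defect in Cauchy-Schwarz is a
      square.\<close>
    have "(1 + s\<^sup>2 / real M) * (\<mu>\<^sup>2 + real M * X\<^sup>2) - (\<mu> + s * X)\<^sup>2 =
        (s * \<mu> - real M * X)\<^sup>2 / real M"
      using assms by (simp add: field_simps power2_eq_square)
    moreover have "0 \<le> (s * \<mu> - real M * X)\<^sup>2 / real M" by simp
    ultimately show ?thesis by linarith
  qed
  moreover have "\<dots> \<le> (1 + s\<^sup>2 / real M) * (\<mu>\<^sup>2 + S)"
    using X by (intro mult_left_mono) auto
  ultimately show ?thesis
    unfolding S_def[symmetric] real_sqrt_mult[symmetric] by (intro real_le_rsqrt) auto
qed

text \<open>Later \<open>V\<close> is \<open>polys_le N D\<close> and \<open>s\<close> is the root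
  of \<Delta>. Closure under linear combinations puts the conditional expectations of
  \<open>F\<close> back into \<open>V\<close>, where \<open>adv\<close> applies to them.\<close>

lemma planted_mean_le:
  fixes a :: "'b \<Rightarrow> real" and m :: "'b \<Rightarrow> nat \<Rightarrow> 'a \<Rightarrow> real" and V :: "('a \<Rightarrow> real) set"
  assumes P: "prob_space P" and Q: "prob_space Q" and M: "0 < M" and s: "0 \<le> s"
    and V_const: "\<And>t. (\<lambda>_. t) \<in> V"
    and V_add: "\<And>f g. f \<in> V \<Longrightarrow> g \<in> V \<Longrightarrow> (\<lambda>y. f y + g y) \<in> V"
    and V_cmult: "\<And>t f. f \<in> V \<Longrightarrow> (\<lambda>y. t * f y) \<in> V"
    and V_P: "\<And>f. f \<in> V \<Longrightarrow> integrable P f"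
    and V_Q: "\<And>f. f \<in> V \<Longrightarrow> square_integrable Q f"
    and adv: "\<And>f. f \<in> V \<Longrightarrow> (\<integral>y. f y \<partial>P) \<le> s * sqrt (\<integral>y. (f y)\<^sup>2 \<partial>Q)"
    and m: "\<And>\<alpha> j. \<alpha> \<in> I \<Longrightarrow> j < M \<Longrightarrow> m \<alpha> j \<in> V"
  defines "F \<equiv> \<lambda>Y. \<Sum>\<alpha>\<in>I. a \<alpha> * (\<Prod>j<M. m \<alpha> j (Y j))"
  shows "\<And>k. k < M \<Longrightarrow> integrable (PiM {..<M} (\<lambda>j. if j = k then P else Q)) F"
    and "(\<Sum>k<M. \<integral>Y. F Y \<partial>PiM {..<M} (\<lambda>j. if j = k then P else Q)) / real M \<le>
      sqrt (1 + s\<^sup>2 / real M) * sqrt (\<integral>Y. (F Y)\<^sup>2 \<partial>PiM {..<M} (\<lambda>_. Q))"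
proof -
  let ?Q = "PiM {..<M} (\<lambda>_. Q)" and ?P = "\<lambda>k. PiM {..<M} (\<lambda>j. if j = k then P else Q)"
  interpret Q: prob_space Q by fact
  interpret P: prob_space P by fact
  interpret QM: prob_space ?Q by (intro prob_space_PiM Q)
  note V_Qi = square_integrable_imp_integrable[OF Q V_Q]
  have V_sum: "(\<lambda>y. \<Sum>i\<in>J. f i y) \<in> V" if "\<And>i. i \<in> J \<Longrightarrow> f i \<in> V" for J :: "'b set" and f
    using that by (induction J rule: infinite_finite_induct) (auto intro: V_add V_const)
  define c where "c = (\<lambda>\<alpha> j. \<integral>y. m \<alpha> j y \<partial>Q)"
  define b where "b = (\<lambda>\<alpha> k. a \<alpha> * (\<Prod>j\<in>{..<M} - {k}. c \<alpha> j))"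
  \<comment> \<open>\<open>f k\<close> is the conditional expectation of \<open>F\<close> given
    sample \<open>k\<close> under the null law, and \<open>\<mu>\<close> is the mean of
    \<open>F\<close>.\<close>
  define f where "f = (\<lambda>k y. \<Sum>\<alpha>\<in>I. b \<alpha> k * m \<alpha> k y)"
  define \<mu> where "\<mu> = (\<Sum>\<alpha>\<in>I. a \<alpha> * (\<Prod>j<M. c \<alpha> j))"
  \<comment> \<open>Applying \<open>adv\<close> to \<open>f k\<close> itself would multiply
    \<open>\<mu>\<close> by \<open>s\<close> as well; centring confines the loss to the
    fluctuations.\<close>
  define g where "g = (\<lambda>k y. f k y + - \<mu>)"
  have f: "f k \<in> V" if "k < M" for k
    unfolding f_def using that by (intro V_sum V_cmult m)
  have g: "g k \<in> V" if "k < M" for k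
    unfolding g_def using f that by (intro V_add V_const)
  have f_mean: "(\<integral>y. f k y \<partial>Q) = \<mu>" if k: "k < M" for k
  proof -
    have "(\<integral>y. f k y \<partial>Q) = (\<Sum>\<alpha>\<in>I. b \<alpha> k * c \<alpha> k)"
      unfolding f_def c_def using m k V_Qi by (subst Bochner_Integration.integral_sum) auto
    also have "\<dots> = \<mu>"
      unfolding \<mu>_def b_def using k
      by (intro sum.cong refl) (simp add: prod.remove[of "{..<M}" k] mult_ac)
    finally show ?thesis .
  qed
  have g_mean: "(\<integral>y. g k y \<partial>Q) = 0" if "k < M" for k
    using that f_mean V_Qi f by (simp add: g_def Q.prob_space)
  have F_sq: "square_integrable ?Q F"
    unfolding F_def using Q m V_Q
    by (intro square_integrable_sum QM.prob_space_axioms square_integrable_cmult square_integrable_prod) auto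
  have F_proj: "(\<integral>Y. F Y * h (Y k) \<partial>?Q) = (\<integral>y. f k y * h y \<partial>Q)"
    if k: "k < M" and h: "h \<in> V" for k h
  proof -
    have "(\<integral>Y. F Y * h (Y k) \<partial>?Q) =
        (\<integral>Y. (\<Sum>\<alpha>\<in>I. a \<alpha> * ((\<Prod>j<M. m \<alpha> j (Y j)) * h (Y k))) \<partial>?Q)"
      by (simp add: F_def sum_distrib_right mult.assoc)
    also have "\<dots> = (\<Sum>\<alpha>\<in>I. a \<alpha> * (\<integral>Y. (\<Prod>j<M. m \<alpha> j (Y j)) * h (Y k) \<partial>?Q))"
      using k h m V_Q Q
      by (subst Bochner_Integration.integral_sum)
        (auto intro!: integrable_mult_right integrable_mult_square_integrable square_integrable_prod
          square_integrable_component)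
    also have "\<dots> = (\<Sum>\<alpha>\<in>I. b \<alpha> k * (\<integral>y. m \<alpha> k y * h y \<partial>Q))"
      using k h m V_Q Q
      by (intro sum.cong refl) (simp add: integral_prod_mult_component b_def c_def)
    also have "\<dots> = (\<integral>y. (\<Sum>\<alpha>\<in>I. b \<alpha> k * (m \<alpha> k y * h y)) \<partial>Q)"
      using k h m V_Q
      by (subst Bochner_Integration.integral_sum)
        (auto intro!: integrable_mult_right integrable_mult_square_integrable)
    also have "\<dots> = (\<integral>y. f k y * h y \<partial>Q)"
      by (simp add: f_def sum_distrib_right mult.assoc)
    finally show ?thesis .
  qed
  \<comment> \<open>The projection identity with \<open>h = 1\<close> at sample 0, which exists
    because \<open>0 < M\<close>.\<close>
  have F_mean: "(\<integral>Y. F Y \<partial>?Q) = \<mu>"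
    using F_proj[OF M V_const[of 1]] f_mean[OF M] by simp
  have F_g: "(\<integral>Y. F Y * g k (Y k) \<partial>?Q) = (\<integral>y. (g k y)\<^sup>2 \<partial>Q)" if k: "k < M" for k
  proof -
    have gi: "integrable Q (g k)" "integrable Q (\<lambda>y. (g k y)\<^sup>2)"
      using V_Qi[OF g[OF k]] V_Q[OF g[OF k]] by (auto simp: square_integrable_def)
    have "(\<integral>y. f k y * g k y \<partial>Q) = (\<integral>y. (g k y)\<^sup>2 + \<mu> * g k y \<partial>Q)"
      by (intro Bochner_Integration.integral_cong refl) (simp add: g_def power2_eq_square algebra_simps)
    also have "\<dots> = (\<integral>y. (g k y)\<^sup>2 \<partial>Q)"
      using gi g_mean[OF k] by simp
    finally show ?thesis using F_proj[OF k g[OF k]] by simp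
  qed
  have g_comp: "square_integrable ?Q (\<lambda>Y. g k (Y k))" if "k < M" for k
    using that Q V_Q g by (intro square_integrable_component) auto
  have g_g: "(\<integral>Y. g l (Y l) * g k (Y k) \<partial>?Q) = (if l = k then \<integral>y. (g k y)\<^sup>2 \<partial>Q else 0)"
    if k: "k < M" and l: "l < M" for k l
  proof -
    let ?u = "\<lambda>j. if j = l then g l else (\<lambda>_. 1)"
    have u: "square_integrable Q (?u j)" for j
      using V_Q[OF g[OF l]] Q by simp
    have "(\<Prod>j<M. ?u j (Y j)) = g l (Y l)" for Y :: "nat \<Rightarrow> 'a"
      using l by (simp add: if_distribR prod.delta)
    then have "(\<integral>Y. g l (Y l) * g k (Y k) \<partial>?Q) =
        (\<integral>y. ?u k y * g k y \<partial>Q) * (\<Prod>j\<in>{..<M} - {k}. \<integral>y. ?u j y \<partial>Q)"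
      using integral_prod_mult_component[of Q M ?u, OF Q u V_Q[OF g[OF k]] k] by (simp only:)
    also have "\<dots> = (if l = k then \<integral>y. (g k y)\<^sup>2 \<partial>Q else 0)"
    proof (cases "l = k")
      case True
      then have "(\<Prod>j\<in>{..<M} - {k}. \<integral>y. ?u j y \<partial>Q) = 1"
        by (intro prod.neutral) (simp add: Q.prob_space)
      then show ?thesis using True by (simp add: power2_eq_square)
    qed (simp add: g_mean[OF k])
    finally show ?thesis .
  qed
  \<comment> \<open>\<open>G\<close> is the projection of \<open>F\<close> onto the constants and
    the centred functions \<open>g k\<close>, and \<open>S\<close> is its squared norm.\<close>
  define G where "G = (\<lambda>Y. \<mu> + (\<Sum>k<M. g k (Y k)))"
  define S where "S = \<mu>\<^sup>2 + (\<Sum>k<M. \<integral>y. (g k y)\<^sup>2 \<partial>Q)"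
  have G_sq: "square_integrable ?Q G"
    unfolding G_def using g_comp QM.prob_space_axioms
    by (intro square_integrable_add square_integrable_sum square_integrable_const) auto
  \<comment> \<open>Used with \<open>H\<close> equal to \<open>F\<close>, to \<open>G\<close> and to
    a single centred function, so that both the inner product of \<open>F\<close> with
    \<open>G\<close> and the squared norm of \<open>G\<close> come out as \<open>S\<close>.\<close>
  have mult_G: "(\<integral>Y. H Y * G Y \<partial>?Q) =
      \<mu> * (\<integral>Y. H Y \<partial>?Q) + (\<Sum>k<M. \<integral>Y. H Y * g k (Y k) \<partial>?Q)"
    if H: "square_integrable ?Q H" for H
  proof -
    have "(\<integral>Y. H Y * G Y \<partial>?Q) = (\<integral>Y. \<mu> * H Y + (\<Sum>k<M. H Y * g k (Y k)) \<partial>?Q)"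
      by (simp add: G_def algebra_simps sum_distrib_left)
    also have "\<dots> = (\<integral>Y. \<mu> * H Y \<partial>?Q) + (\<integral>Y. (\<Sum>k<M. H Y * g k (Y k)) \<partial>?Q)"
      using H g_comp square_integrable_imp_integrable[OF QM.prob_space_axioms H]
      by (intro Bochner_Integration.integral_add)
        (auto intro!: Bochner_Integration.integrable_sum integrable_mult_square_integrable)
    also have "(\<integral>Y. (\<Sum>k<M. H Y * g k (Y k)) \<partial>?Q) = (\<Sum>k<M. \<integral>Y. H Y * g k (Y k) \<partial>?Q)"
      using H g_comp
      by (intro Bochner_Integration.integral_sum) (auto intro!: integrable_mult_square_integrable)
    finally show ?thesis by simp
  qed
  have F_G: "(\<integral>Y. F Y * G Y \<partial>?Q) = S"
    using mult_G[OF F_sq] F_mean F_g by (simp add: S_def power2_eq_square)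
  have g_comp_mean: "(\<integral>Y. g k (Y k) \<partial>?Q) = 0" if k: "k < M" for k
    using integral_prod_mult_component[OF Q _ V_Q[OF g[OF k]] k, of "\<lambda>_ _. 1"] g_mean[OF k] Q
    by simp
  have G_mean: "(\<integral>Y. G Y \<partial>?Q) = \<mu>"
    unfolding G_def using g_comp square_integrable_imp_integrable[OF QM.prob_space_axioms g_comp]
    by (subst Bochner_Integration.integral_add)
      (auto simp: QM.prob_space Bochner_Integration.integral_sum g_comp_mean)
  have G_g: "(\<integral>Y. G Y * g k (Y k) \<partial>?Q) = (\<integral>y. (g k y)\<^sup>2 \<partial>Q)" if k: "k < M" for k
  proof -
    have "(\<integral>Y. G Y * g k (Y k) \<partial>?Q) = (\<integral>Y. g k (Y k) * G Y \<partial>?Q)"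
      by (simp add: mult.commute)
    also have "\<dots> = (\<Sum>l<M. \<integral>Y. g k (Y k) * g l (Y l) \<partial>?Q)"
      using mult_G[OF g_comp[OF k]] g_comp_mean[OF k] by simp
    also have "\<dots> = (\<Sum>l<M. if l = k then \<integral>y. (g k y)\<^sup>2 \<partial>Q else 0)"
      using g_g k by (intro sum.cong) auto
    also have "\<dots> = (\<integral>y. (g k y)\<^sup>2 \<partial>Q)"
      using k by simp
    finally show ?thesis .
  qed
  have G_G: "(\<integral>Y. (G Y)\<^sup>2 \<partial>?Q) = S"
    using mult_G[OF G_sq] G_mean G_g by (simp add: S_def power2_eq_square)
  have S_le: "S \<le> (\<integral>Y. (F Y)\<^sup>2 \<partial>?Q)"
    using integral_square_projection_le[OF F_sq G_sq] F_G G_G by simp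
  show F_int: "integrable (?P k) F" if k: "k < M" for k
    unfolding F_def using k m V_P V_Qi P Q
    by (intro Bochner_Integration.integrable_sum integrable_mult_right integral_prod_planted(1)) auto
  \<comment> \<open>With the informative sample at \<open>k\<close> all the others still follow
    \<open>Q\<close>, so the planted mean of \<open>F\<close> is the mean of
    \<open>f k = g k + \<mu>\<close> under \<open>P\<close>.\<close>
  have F_P: "(\<integral>Y. F Y \<partial>?P k) \<le> \<mu> + s * sqrt (\<integral>y. (g k y)\<^sup>2 \<partial>Q)" if k: "k < M" for k
  proof -
    have "(\<integral>Y. F Y \<partial>?P k) = (\<Sum>\<alpha>\<in>I. a \<alpha> * (\<integral>Y. (\<Prod>j<M. m \<alpha> j (Y j)) \<partial>?P k))"
      unfolding F_def using k m V_P V_Qi P Q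
      by (subst Bochner_Integration.integral_sum)
        (auto intro!: integrable_mult_right integral_prod_planted(1))
    also have "\<dots> = (\<Sum>\<alpha>\<in>I. b \<alpha> k * (\<integral>y. m \<alpha> k y \<partial>P))"
      using k m V_P V_Qi P Q
      by (intro sum.cong refl) (simp add: integral_prod_planted(2) b_def c_def)
    also have "\<dots> = (\<integral>y. f k y \<partial>P)"
      unfolding f_def using k m V_P by (subst Bochner_Integration.integral_sum) auto
    also have "\<dots> = (\<integral>y. g k y + \<mu> \<partial>P)" by (simp add: g_def)
    also have "\<dots> = (\<integral>y. g k y \<partial>P) + \<mu>"
      using V_P[OF g[OF k]] by (simp add: P.prob_space)
    finally show ?thesis using adv[OF g[OF k]] by simp
  qed
  have "(\<Sum>k<M. \<integral>Y. F Y \<partial>?P k) / real M \<le>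
      (\<Sum>k<M. \<mu> + s * sqrt (\<integral>y. (g k y)\<^sup>2 \<partial>Q)) / real M"
    using F_P by (intro divide_right_mono sum_mono) auto
  also have "\<dots> \<le> sqrt (1 + s\<^sup>2 / real M) *
      sqrt (\<mu>\<^sup>2 + (\<Sum>k<M. (sqrt (\<integral>y. (g k y)\<^sup>2 \<partial>Q))\<^sup>2))"
    by (rule planted_cauchy_schwarz[OF M s])
  also have "\<dots> = sqrt (1 + s\<^sup>2 / real M) * sqrt S"
    by (simp add: S_def)
  also have "\<dots> \<le> sqrt (1 + s\<^sup>2 / real M) * sqrt (\<integral>Y. (F Y)\<^sup>2 \<partial>?Q)"
    using S_le by (intro mult_left_mono) auto
  finally show "(\<Sum>k<M. \<integral>Y. F Y \<partial>?P k) / real M \<le>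
      sqrt (1 + s\<^sup>2 / real M) * sqrt (\<integral>Y. (F Y)\<^sup>2 \<partial>?Q)" .
qed

section \<open>Advantage and errors in the hidden informative sample problem\<close>

lemma finite_multi_indices [simp]: "finite (multi_indices N D)"
proof (rule finite_subset)
  show "multi_indices N D \<subseteq>
      {\<alpha>. \<forall>i. (i \<in> {..<N} \<longrightarrow> \<alpha> i \<in> {..D}) \<and> (i \<notin> {..<N} \<longrightarrow> \<alpha> i = 0)}"
  proof (clarsimp simp: multi_indices_def)
    fix \<alpha> :: "nat \<Rightarrow> nat" and i assume "sum \<alpha> {..<N} \<le> D" "i < N"
    then show "\<alpha> i \<le> D"
      using member_le_sum[of i "{..<N}" \<alpha>] by simp
  qed
qed (rule finite_set_of_finite_funs, auto)

lemma monomial_in_polys_le: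
  assumes "\<beta> \<in> multi_indices N D"
  shows "(\<lambda>y. \<Prod>i<N. y i ^ \<beta> i) \<in> polys_le N D"
proof -
  have "(\<Sum>\<alpha>\<in>multi_indices N D. (if \<alpha> = \<beta> then 1 else 0) * (\<Prod>i<N. y i ^ \<alpha> i)) =
      (\<Prod>i<N. y i ^ \<beta> i)" for y :: "nat \<Rightarrow> real"
  proof -
    have "(\<Sum>\<alpha>\<in>multi_indices N D. (if \<alpha> = \<beta> then 1 else 0) * (\<Prod>i<N. y i ^ \<alpha> i)) =
        (\<Sum>\<alpha>\<in>multi_indices N D. if \<alpha> = \<beta> then (\<Prod>i<N. y i ^ \<alpha> i) else 0)"
      by (intro sum.cong) auto
    then show ?thesis using assms by simp
  qed
  then show ?thesis
    unfolding polys_le_def by (intro CollectI exI[of _ "\<lambda>\<alpha>. if \<alpha> = \<beta> then 1 else 0"]) auto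
qed

lemma polys_le_add:
  assumes "f \<in> polys_le N D" and "g \<in> polys_le N D"
  shows "(\<lambda>y. f y + g y) \<in> polys_le N D"
proof -
  obtain a b where "f = (\<lambda>y. \<Sum>\<alpha>\<in>multi_indices N D. a \<alpha> * (\<Prod>i<N. y i ^ \<alpha> i))"
    "g = (\<lambda>y. \<Sum>\<alpha>\<in>multi_indices N D. b \<alpha> * (\<Prod>i<N. y i ^ \<alpha> i))"
    using assms unfolding polys_le_def by blast
  then show ?thesis
    unfolding polys_le_def
    by (intro CollectI exI[of _ "\<lambda>\<alpha>. a \<alpha> + b \<alpha>"]) (simp add: distrib_right sum.distrib)
qed

lemma polys_le_cmult:
  assumes "f \<in> polys_le N D"
  shows "(\<lambda>y. t * f y) \<in> polys_le N D"
proof -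
  obtain a where "f = (\<lambda>y. \<Sum>\<alpha>\<in>multi_indices N D. a \<alpha> * (\<Prod>i<N. y i ^ \<alpha> i))"
    using assms unfolding polys_le_def by blast
  then show ?thesis
    unfolding polys_le_def
    by (intro CollectI exI[of _ "\<lambda>\<alpha>. t * a \<alpha>"]) (simp add: sum_distrib_left mult.assoc)
qed

lemma polys_le_const: "(\<lambda>y. t) \<in> polys_le N D"
proof -
  have "(\<lambda>y. \<Prod>i<N. y i ^ 0) \<in> polys_le N D"
    using monomial_in_polys_le[of "\<lambda>_. 0" N D] by (simp add: multi_indices_def)
  from polys_le_cmult[OF this, of t] show ?thesis by simp
qed

lemma polys_le_measurable:
  assumes "f \<in> polys_le N D"
  shows "f \<in> borel_measurable (Rn N)"
proof -
  obtain a where "f = (\<lambda>y. \<Sum>\<alpha>\<in>multi_indices N D. a \<alpha> * (\<Prod>i<N. y i ^ \<alpha> i))"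
    using assms unfolding polys_le_def by blast
  then show ?thesis
    by (auto simp: Rn_def intro!: borel_measurable_sum borel_measurable_times
        borel_measurable_prod borel_measurable_power measurable_component_singleton)
qed

section \<open>Concatenated samples and their blocks\<close>

definition block_index :: "nat \<Rightarrow> (nat \<Rightarrow> nat) \<Rightarrow> nat \<Rightarrow> nat \<Rightarrow> nat" where
  "block_index N \<alpha> j i = (if i < N then \<alpha> (j * N + i) else 0)"

lemma block_index_in_multi_indices:
  assumes "\<alpha> \<in> multi_indices (N * M) D" and "j < M"
  shows "block_index N \<alpha> j \<in> multi_indices N D"
proof -
  have "(\<Sum>i<N. block_index N \<alpha> j i) = (\<Sum>k\<in>(\<lambda>i. j * N + i) ` {..<N}. \<alpha> k)"
    by (subst sum.reindex) (auto simp: inj_on_def block_index_def)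
  also have "\<dots> \<le> (\<Sum>k<N * M. \<alpha> k)"
    using assms(2) by (intro sum_mono2) (auto intro: block_offset_less)
  also have "\<dots> \<le> D" using assms(1) by (simp add: multi_indices_def)
  finally show ?thesis by (simp add: multi_indices_def block_index_def)
qed

lemma monomial_flatten:
  "(\<Prod>k<N * M. flatten N M Y k ^ \<alpha> k) = (\<Prod>j<M. \<Prod>i<N. Y j i ^ block_index N \<alpha> j i)"
proof -
  have "(\<Prod>k<N * M. flatten N M Y k ^ \<alpha> k) =
      (\<Prod>j<M. \<Prod>k\<in>{j * N..<j * N + N}. flatten N M Y k ^ \<alpha> k)"
    by (simp add: prod.nat_group mult.commute)
  also have "\<dots> = (\<Prod>j<M. \<Prod>i<N. Y j i ^ block_index N \<alpha> j i)"
  proof (rule prod.cong[OF refl])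
    fix j assume "j \<in> {..<M}"
    then have j: "j < M" by simp
    have "(\<Prod>k\<in>{j * N..<j * N + N}. flatten N M Y k ^ \<alpha> k) =
        (\<Prod>i\<in>{0..<N}. flatten N M Y (i + j * N) ^ \<alpha> (i + j * N))"
      using prod.shift_bounds_nat_ivl[of "\<lambda>k. flatten N M Y k ^ \<alpha> k" 0 "j * N" N]
      by (simp add: add.commute)
    also have "\<dots> = (\<Prod>i<N. Y j i ^ block_index N \<alpha> j i)"
      unfolding atLeast0LessThan
    proof (rule prod.cong[OF refl])
      fix i assume "i \<in> {..<N}"
      then show "flatten N M Y (i + j * N) ^ \<alpha> (i + j * N) = Y j i ^ block_index N \<alpha> j i"
        using block_offset_less[OF j, of i N] by (simp add: flatten_def block_index_def add.commute)
    qed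
    finally show "(\<Prod>k\<in>{j * N..<j * N + N}. flatten N M Y k ^ \<alpha> k) =
        (\<Prod>i<N. Y j i ^ block_index N \<alpha> j i)" .
  qed
  finally show ?thesis .
qed

text \<open>Points of \<open>Rn N\<close> are \<open>undefined\<close> outside the index set, and
  the restriction in \<open>block\<close> reproduces this value; hence the equality of total
  functions.\<close>

lemma block_flatten:
  assumes "Y j \<in> space (Rn N)" and "j < M"
  shows "block N j (flatten N M Y) = Y j"
proof
  fix i show "block N j (flatten N M Y) i = Y j i"
    using assms block_offset_less[OF assms(2), of i N]
    by (auto simp: block_def flatten_def Rn_def space_PiM PiE_def extensional_def)
qed

lemma flatten_measurable:
  assumes "\<And>j. j < M \<Longrightarrow> sets (R j) = sets (Rn N)"
  shows "flatten N M \<in> PiM {..<M} R \<rightarrow>\<^sub>M Rn (N * M)"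
  unfolding Rn_def flatten_def
proof (rule measurable_restrict)
  fix k assume "k \<in> {..<N * M}"
  then have k: "k < N * M" by simp
  then have N: "0 < N" by (cases N) auto
  from k have j: "k div N < M" by (simp add: less_mult_imp_div_less mult.commute)
  have "(\<lambda>Y. Y (k div N)) \<in> PiM {..<M} R \<rightarrow>\<^sub>M R (k div N)"
    using j by simp
  also have "measurable (PiM {..<M} R) (R (k div N)) = measurable (PiM {..<M} R) (Rn N)"
    by (rule measurable_cong_sets) (simp_all add: assms j)
  finally have 1: "(\<lambda>Y. Y (k div N)) \<in> PiM {..<M} R \<rightarrow>\<^sub>M Rn N" .
  have 2: "(\<lambda>y. y (k mod N)) \<in> Rn N \<rightarrow>\<^sub>M borel"
    using N by (simp add: Rn_def)
  from measurable_compose[OF 1 2]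
  show "(\<lambda>Y. Y (k div N) (k mod N)) \<in> PiM {..<M} R \<rightarrow>\<^sub>M borel" .
qed

lemma block_measurable:
  assumes "j < M"
  shows "block N j \<in> Rn (N * M) \<rightarrow>\<^sub>M Rn N"
  unfolding Rn_def block_def using block_offset_less[OF assms]
  by (intro measurable_restrict measurable_component_singleton) auto

lemma any_block_measurable:
  assumes A: "A \<in> borel_measurable (Rn N)"
  shows "any_block N M A \<in> borel_measurable (Rn (N * M))"
proof -
  let ?S = "\<lambda>j. (\<lambda>z. A (block N j z)) -` {1} \<inter> space (Rn (N * M))"
  have "?S j \<in> sets (Rn (N * M))" if "j \<in> {..<M}" for j
    using that
    by (intro measurable_sets[OF measurable_compose[OF block_measurable A]]) simp_all
  then have "(\<Union>j<M. ?S j) \<in> sets (Rn (N * M))"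
    by (rule sets.finite_UN[OF finite_lessThan])
  also have "(\<Union>j<M. ?S j) = {z \<in> space (Rn (N * M)). \<exists>j<M. A (block N j z) = 1}"
    by auto
  finally have S: "{z \<in> space (Rn (N * M)). \<exists>j<M. A (block N j z) = 1} \<in> sets (Rn (N * M))" .
  show ?thesis
    unfolding any_block_def by (rule measurable_If[OF _ _ S]) simp_all
qed

lemma any_block_sets:
  assumes A: "A \<in> borel_measurable (Rn N)"
  shows "{z \<in> space (Rn (N * M)). any_block N M A z = t} \<in> sets (Rn (N * M))"
proof -
  have "{z \<in> space (Rn (N * M)). any_block N M A z = t} =
      any_block N M A -` {t} \<inter> space (Rn (N * M))"
    by blast
  also have "\<dots> \<in> sets (Rn (N * M))"
    by (rule measurable_sets[OF any_block_measurable[OF A]]) simp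
  finally show ?thesis .
qed

text \<open>The conventions for a zero denominator make the equivalence hold there too. A finite
  advantage thus bounds by 0 the mean under \<open>P\<close> of every polynomial whose second moment
  under \<open>Q\<close> vanishes.\<close>

lemma ereal_quotient_le_iff:
  fixes x y t :: real
  assumes "0 \<le> y" and "0 \<le> t"
  shows "ereal x / ereal y \<le> ereal t \<longleftrightarrow> x \<le> t * y"
proof (cases "y = 0")
  case True
  consider "x < 0" | "x = 0" | "0 < x" by linarith
  then show ?thesis
    by cases (use True assms in \<open>simp_all add: divide_ereal_def\<close>)
next
  case False
  then show ?thesis using assms by (simp add: divide_le_eq)
qed

section \<open>The hidden informative sample problem for fixed parameters\<close>

context
  fixes N M :: nat and P Q :: "(nat \<Rightarrow> real) measure"
  assumes P: "prob_space P" "sets P = sets (Rn N)"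
    and Q: "prob_space Q" "sets Q = sets (Rn N)"
    and M: "0 < M"
begin

abbreviation (input) "planted_at k \<equiv> PiM {..<M} (\<lambda>j. if j = k then P else Q)"

lemma flatten_measurable_planted_at: "flatten N M \<in> planted_at k \<rightarrow>\<^sub>M Rn (N * M)"
  using P Q by (intro flatten_measurable) auto

lemma flatten_measurable_null: "flatten N M \<in> PiM {..<M} (\<lambda>_. Q) \<rightarrow>\<^sub>M Rn (N * M)"
  using Q by (intro flatten_measurable) auto

lemma prob_space_planted_at: "prob_space (planted_at k)"
  using P Q by (intro prob_space_PiM) auto

text \<open>The kernel lives on all natural numbers; for \<open>k\<close> outside
  \<open>{..<M}\<close> its value is the null law, still a probability measure.\<close>

lemma planted_kernel:
  "(\<lambda>k. distr (planted_at k) (Rn (N * M)) (flatten N M)) \<in>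
     measure_pmf (pmf_of_set {..<M}) \<rightarrow>\<^sub>M subprob_algebra (Rn (N * M))"
  by (auto simp: space_subprob_algebra intro!: prob_space_imp_subprob_space
      prob_space.prob_space_distr prob_space_planted_at flatten_measurable_planted_at)

lemma sets_hidden_planted: "sets (hidden_planted N M P Q) = sets (Rn (N * M))"
  unfolding hidden_planted_def by (subst sets_bind[where N = "Rn (N * M)"]) auto

lemma nn_integral_hidden_planted:
  assumes "f \<in> borel_measurable (Rn (N * M))"
  shows "(\<integral>\<^sup>+z. f z \<partial>hidden_planted N M P Q) =
    (\<Sum>k<M. \<integral>\<^sup>+Y. f (flatten N M Y) \<partial>planted_at k) / of_nat M"
  using assms M
  by (simp add: hidden_planted_def nn_integral_bind[OF _ planted_kernel] nn_integral_pmf_of_set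
      nn_integral_distr flatten_measurable_planted_at lessThan_empty_iff)

text \<open>Polynomials are unbounded, so integrability under the mixture has to be derived from
  that under the finitely many components. This is done for positive and negative parts separately,
  where the formula for nonnegative integrals applies.\<close>

lemma integral_hidden_planted:
  fixes f :: "(nat \<Rightarrow> real) \<Rightarrow> real"
  assumes f: "f \<in> borel_measurable (Rn (N * M))"
    and int: "\<And>k. k < M \<Longrightarrow> integrable (planted_at k) (\<lambda>Y. f (flatten N M Y))"
  shows "(\<integral>z. f z \<partial>hidden_planted N M P Q) =
    (\<Sum>k<M. \<integral>Y. f (flatten N M Y) \<partial>planted_at k) / real M"
proof -
  let ?H = "hidden_planted N M P Q"
  have avg: "(\<integral>\<^sup>+z. ennreal (g z) \<partial>?H) =
      ennreal ((\<Sum>k<M. enn2real (\<integral>\<^sup>+Y. ennreal (g (flatten N M Y)) \<partial>planted_at k)) / real M)"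
    if g: "g \<in> borel_measurable (Rn (N * M))"
      and fin: "\<And>k. k < M \<Longrightarrow> (\<integral>\<^sup>+Y. ennreal (g (flatten N M Y)) \<partial>planted_at k) \<noteq> \<infinity>"
    for g :: "(nat \<Rightarrow> real) \<Rightarrow> real"
  proof -
    have "(\<integral>\<^sup>+z. ennreal (g z) \<partial>?H) =
        (\<Sum>k<M. \<integral>\<^sup>+Y. ennreal (g (flatten N M Y)) \<partial>planted_at k) / of_nat M"
      using g by (intro nn_integral_hidden_planted) auto
    also have "(\<Sum>k<M. \<integral>\<^sup>+Y. ennreal (g (flatten N M Y)) \<partial>planted_at k) =
        (\<Sum>k<M. ennreal (enn2real (\<integral>\<^sup>+Y. ennreal (g (flatten N M Y)) \<partial>planted_at k)))"
      using fin by (intro sum.cong refl) (simp add: less_top)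
    also have "\<dots> = ennreal (\<Sum>k<M. enn2real (\<integral>\<^sup>+Y. ennreal (g (flatten N M Y)) \<partial>planted_at k))"
      by (rule sum_ennreal) simp
    finally show ?thesis
      using M by (simp add: divide_ennreal ennreal_of_nat_eq_real_of_nat sum_nonneg)
  qed
  have fin: "(\<integral>\<^sup>+Y. ennreal (f (flatten N M Y)) \<partial>planted_at k) \<noteq> \<infinity>"
    "(\<integral>\<^sup>+Y. ennreal (- f (flatten N M Y)) \<partial>planted_at k) \<noteq> \<infinity>" if "k < M" for k
    using int[OF that] by (auto simp: real_integrable_def)
  note pos = avg[OF f fin(1)] and neg = avg[OF borel_measurable_uminus[OF f] fin(2)]
  have "integrable ?H f"
    unfolding real_integrable_def using f pos neg
    by (auto simp: measurable_cong_sets[OF sets_hidden_planted refl])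
  then have "(\<integral>z. f z \<partial>?H) =
      enn2real (\<integral>\<^sup>+z. ennreal (f z) \<partial>?H) - enn2real (\<integral>\<^sup>+z. ennreal (- f z) \<partial>?H)"
    by (rule real_lebesgue_integral_def)
  also have "\<dots> = (\<Sum>k<M. enn2real (\<integral>\<^sup>+Y. ennreal (f (flatten N M Y)) \<partial>planted_at k) -
      enn2real (\<integral>\<^sup>+Y. ennreal (- f (flatten N M Y)) \<partial>planted_at k)) / real M"
    by (simp add: pos neg sum_nonneg sum_subtractf diff_divide_distrib)
  also have "\<dots> = (\<Sum>k<M. \<integral>Y. f (flatten N M Y) \<partial>planted_at k) / real M"
    using int by (simp add: real_lebesgue_integral_def)
  finally show ?thesis .
qed

lemma prob_space_hidden_planted: "prob_space (hidden_planted N M P Q)"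
  unfolding hidden_planted_def
  by (intro prob_space.prob_space_bind[OF measure_pmf.prob_space_axioms _ planted_kernel] AE_I2
      prob_space.prob_space_distr prob_space_planted_at flatten_measurable_planted_at)

lemma prob_space_hidden_null: "prob_space (hidden_null N M Q)"
  unfolding hidden_null_def
  by (intro prob_space.prob_space_distr prob_space_PiM Q(1) flatten_measurable_null)

text \<open>Witnessed by the constant polynomial 1; this is the lower half of the convergence to
  1.\<close>

lemma Adv_hidden_ge_1: "1 \<le> Adv (N * M) D (hidden_planted N M P Q) (hidden_null N M Q)"
proof -
  interpret P: prob_space "hidden_planted N M P Q" by (rule prob_space_hidden_planted)
  interpret Q: prob_space "hidden_null N M Q" by (rule prob_space_hidden_null)
  show ?thesis
    unfolding Adv_def
    by (rule SUP_upper2[OF polys_le_const[of 1]]) (simp add: P.prob_space Q.prob_space one_ereal_def)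
qed

text \<open>A monomial in the concatenated sample is a product of monomials in single samples, each
  of degree at most \<open>D\<close>, so \<open>planted_mean_le\<close> applies.\<close>

lemma Adv_hidden_le:
  assumes moments: "\<And>f. f \<in> polys_le N D \<Longrightarrow> integrable P f \<and> integrable Q (\<lambda>y. (f y)\<^sup>2)"
    and s: "0 \<le> s" and Adv: "Adv N D P Q \<le> ereal s"
  shows "Adv (N * M) D (hidden_planted N M P Q) (hidden_null N M Q) \<le>
    ereal (sqrt (1 + s\<^sup>2 / real M))"
proof -
  have adv: "(\<integral>y. f y \<partial>P) \<le> s * sqrt (\<integral>y. (f y)\<^sup>2 \<partial>Q)" if "f \<in> polys_le N D" for f
  proof -
    have "ereal (\<integral>y. f y \<partial>P) / ereal (sqrt (\<integral>y. (f y)\<^sup>2 \<partial>Q)) \<le> ereal s"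
      by (rule order_trans[OF SUP_upper[OF that] Adv[unfolded Adv_def]])
    moreover have "0 \<le> sqrt (\<integral>y. (f y)\<^sup>2 \<partial>Q)" by simp
    ultimately show ?thesis using ereal_quotient_le_iff s by blast
  qed
  have V_P: "integrable P f" if "f \<in> polys_le N D" for f
    using moments[OF that] by simp
  have sq: "square_integrable Q f" if "f \<in> polys_le N D" for f
    using moments[OF that] polys_le_measurable[OF that]
    by (simp add: square_integrable_def measurable_cong_sets[OF Q(2) refl])
  have monomial: "(\<lambda>y. \<Prod>i<N. y i ^ block_index N \<alpha> j i) \<in> polys_le N D"
    if "\<alpha> \<in> multi_indices (N * M) D" "j < M" for \<alpha> j
    using that by (intro monomial_in_polys_le block_index_in_multi_indices)
  show ?thesis
    unfolding Adv_def
  proof (rule SUP_least)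
    fix f assume f: "f \<in> polys_le (N * M) D"
    then obtain a where a: "f = (\<lambda>z. \<Sum>\<alpha>\<in>multi_indices (N * M) D. a \<alpha> * (\<Prod>k<N * M. z k ^ \<alpha> k))"
      unfolding polys_le_def by blast
    define F where "F = (\<lambda>Y. \<Sum>\<alpha>\<in>multi_indices (N * M) D.
        a \<alpha> * (\<Prod>j<M. \<Prod>i<N. Y j i ^ block_index N \<alpha> j i))"
    have fF: "f (flatten N M Y) = F Y" for Y
      by (simp add: a F_def monomial_flatten)
    note planted = planted_mean_le[where V = "polys_le N D" and I = "multi_indices (N * M) D"
        and m = "\<lambda>\<alpha> j y. \<Prod>i<N. y i ^ block_index N \<alpha> j i" and a = a
        and P = P and Q = Q and M = M and s = s, OF P(1) Q(1) M s]
    have F_int: "integrable (planted_at k) F" if "k < M" for k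
      unfolding F_def
      by (rule planted(1); (rule polys_le_const | erule (1) polys_le_add | erule polys_le_cmult |
          erule V_P | erule sq | erule adv | erule (1) monomial | rule that)?)
    have F_mean: "(\<Sum>k<M. \<integral>Y. F Y \<partial>planted_at k) / real M \<le>
        sqrt (1 + s\<^sup>2 / real M) * sqrt (\<integral>Y. (F Y)\<^sup>2 \<partial>PiM {..<M} (\<lambda>_. Q))"
      unfolding F_def
      by (rule planted(2); (rule polys_le_const | erule (1) polys_le_add | erule polys_le_cmult |
          erule V_P | erule sq | erule adv | erule (1) monomial)?)
    have "(\<integral>z. f z \<partial>hidden_planted N M P Q) =
        (\<Sum>k<M. \<integral>Y. f (flatten N M Y) \<partial>planted_at k) / real M"
    proof (rule integral_hidden_planted[OF polys_le_measurable[OF f]])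
      fix k assume "k < M"
      then show "integrable (planted_at k) (\<lambda>Y. f (flatten N M Y))"
        unfolding fF by (rule F_int)
    qed
    also have "\<dots> = (\<Sum>k<M. \<integral>Y. F Y \<partial>planted_at k) / real M"
      unfolding fF ..
    also have "\<dots> \<le> sqrt (1 + s\<^sup>2 / real M) * sqrt (\<integral>Y. (F Y)\<^sup>2 \<partial>PiM {..<M} (\<lambda>_. Q))"
      by (rule F_mean)
    also have "(\<integral>Y. (F Y)\<^sup>2 \<partial>PiM {..<M} (\<lambda>_. Q)) = (\<integral>z. (f z)\<^sup>2 \<partial>hidden_null N M Q)"
      unfolding hidden_null_def
      using polys_le_measurable[OF f]
      by (subst integral_distr[OF flatten_measurable_null]) (simp_all add: fF[symmetric])
    finally show "ereal (\<integral>z. f z \<partial>hidden_planted N M P Q) /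
        ereal (sqrt (\<integral>z. (f z)\<^sup>2 \<partial>hidden_null N M Q)) \<le> ereal (sqrt (1 + s\<^sup>2 / real M))"
      by (subst ereal_quotient_le_iff) auto
  qed
qed

text \<open>The union bound, since every sample has marginal law \<open>Q\<close>.\<close>

lemma measure_null_any_block_le:
  assumes A: "A \<in> borel_measurable (Rn N)"
  shows "measure (hidden_null N M Q) {z \<in> space (hidden_null N M Q). any_block N M A z = 1} \<le>
    real M * measure Q {y \<in> space Q. A y = 1}"
proof -
  let ?Q = "PiM {..<M} (\<lambda>_. Q)" and ?S = "{y \<in> space Q. A y = 1}"
  let ?E = "\<lambda>j. (\<lambda>Y. Y j) -` ?S \<inter> space ?Q"
  interpret QM: prob_space ?Q by (intro prob_space_PiM Q(1))
  have sp: "space Q = space (Rn N)" using Q(2) by (rule sets_eq_imp_space_eq)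
  have "A \<in> borel_measurable Q" using A by (simp add: measurable_cong_sets[OF Q(2) refl])
  then have S: "?S \<in> sets Q" by measurable
  have comp: "(\<lambda>Y. Y j) \<in> ?Q \<rightarrow>\<^sub>M Q" if "j < M" for j
    using that by (intro measurable_component_singleton) simp
  have E: "?E j \<in> sets ?Q" if "j < M" for j
    by (rule measurable_sets[OF comp[OF that] S])
  have E_measure: "measure ?Q (?E j) = measure Q ?S" if j: "j < M" for j
  proof -
    have "distr ?Q Q (\<lambda>Y. Y j) = Q"
      using distr_PiM_component[of "{..<M}" "\<lambda>_. Q" j] j Q(1) by simp
    then show ?thesis using measure_distr[OF comp[OF j] S] by simp
  qed
  have "measure (hidden_null N M Q) {z \<in> space (hidden_null N M Q). any_block N M A z = 1} =
      measure ?Q (flatten N M -` {z \<in> space (Rn (N * M)). any_block N M A z = 1} \<inter> space ?Q)"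
    unfolding hidden_null_def space_distr
    by (rule measure_distr[OF flatten_measurable_null any_block_sets[OF A]])
  also have "\<dots> \<le> measure ?Q (\<Union>j<M. ?E j)"
  proof (rule QM.finite_measure_mono)
    show "flatten N M -` {z \<in> space (Rn (N * M)). any_block N M A z = 1} \<inter> space ?Q \<subseteq> (\<Union>j<M. ?E j)"
    proof
      fix Y assume Y: "Y \<in> flatten N M -` {z \<in> space (Rn (N * M)). any_block N M A z = 1} \<inter> space ?Q"
      then have "any_block N M A (flatten N M Y) = 1" by simp
      then obtain j where j: "j < M" "A (block N j (flatten N M Y)) = 1"
        unfolding any_block_def by (metis zero_neq_one)
      have y: "Y j \<in> space Q" using measurable_space[OF comp[OF j(1)]] Y by simp
      have "block N j (flatten N M Y) = Y j"
        using y j(1) unfolding sp by (intro block_flatten) simp_all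
      then show "Y \<in> (\<Union>j<M. ?E j)"
        using j Y y by auto
    qed
    show "(\<Union>j<M. ?E j) \<in> sets ?Q"
      using E by (intro sets.finite_UN) auto
  qed
  also have "\<dots> \<le> (\<Sum>j<M. measure ?Q (?E j))"
    using E by (intro QM.finite_measure_subadditive_finite) auto
  also have "\<dots> = real M * measure Q ?S"
    using E_measure by simp
  finally show ?thesis .
qed

text \<open>The combined test can answer 0 only if the original one fails to answer 1 on the
  informative sample, whose marginal law is \<open>P\<close> at whatever position \<open>k\<close>
  it sits.\<close>

lemma measure_planted_any_block_le:
  assumes A: "A \<in> borel_measurable (Rn N)"
  shows "measure (hidden_planted N M P Q) {z \<in> space (hidden_planted N M P Q). any_block N M A z = 0}
    \<le> 1 - measure P {y \<in> space P. A y = 1}"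
proof -
  interpret P: prob_space P by (rule P(1))
  have A_P: "A \<in> borel_measurable P" using A by (simp add: measurable_cong_sets[OF P(2) refl])
  have sp: "space P = space (Rn N)" using P(2) by (rule sets_eq_imp_space_eq)
  define B where "B = {z \<in> space (Rn (N * M)). any_block N M A z = 0}"
  have B: "B \<in> sets (Rn (N * M))"
    unfolding B_def by (rule any_block_sets[OF A])
  have neg: "{y \<in> space P. A y \<noteq> 1} = space P - {y \<in> space P. A y = 1}"
    by auto
  have pos: "{y \<in> space P. A y = 1} \<in> sets P"
    using A_P by measurable
  have spH: "space (hidden_planted N M P Q) = space (Rn (N * M))"
    using sets_hidden_planted by (rule sets_eq_imp_space_eq)
  have le: "(\<integral>Y. indicator B (flatten N M Y) \<partial>planted_at k) \<le> 1 - measure P {y \<in> space P. A y = 1}"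
    and int: "integrable (planted_at k) (\<lambda>Y. indicator B (flatten N M Y) :: real)"
    if k: "k < M" for k
  proof -
    interpret PK: prob_space "planted_at k" by (rule prob_space_planted_at)
    show "integrable (planted_at k) (\<lambda>Y. indicator B (flatten N M Y) :: real)"
      using measurable_compose[OF flatten_measurable_planted_at borel_measurable_indicator[OF B]]
      by (intro PK.integrable_const_bound[of _ 1]) (auto simp: indicator_def)
    have comp: "(\<lambda>Y. Y k) \<in> planted_at k \<rightarrow>\<^sub>M P"
      using k measurable_component_singleton[of k "{..<M}" "\<lambda>j. if j = k then P else Q"] by simp
    have "(\<integral>Y. indicator B (flatten N M Y) \<partial>planted_at k) =
        (\<integral>Y. indicator (flatten N M -` B \<inter> space (planted_at k)) Y \<partial>planted_at k)"
      by (intro Bochner_Integration.integral_cong refl) (auto simp: indicator_def)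
    also have "\<dots> = measure (planted_at k) (flatten N M -` B \<inter> space (planted_at k))"
      by (simp add: measurable_sets[OF flatten_measurable_planted_at B])
    also have "\<dots> \<le> measure (planted_at k) ((\<lambda>Y. Y k) -` {y \<in> space P. A y \<noteq> 1} \<inter> space (planted_at k))"
    proof (rule PK.finite_measure_mono)
      show "(\<lambda>Y. Y k) -` {y \<in> space P. A y \<noteq> 1} \<inter> space (planted_at k) \<in> sets (planted_at k)"
        unfolding neg by (intro measurable_sets[OF comp] sets.compl_sets pos)
      show "flatten N M -` B \<inter> space (planted_at k) \<subseteq>
          (\<lambda>Y. Y k) -` {y \<in> space P. A y \<noteq> 1} \<inter> space (planted_at k)"
      proof
        fix Y assume Y: "Y \<in> flatten N M -` B \<inter> space (planted_at k)"
        then have yk: "Y k \<in> space P" using measurable_space[OF comp] by auto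
        have "any_block N M A (flatten N M Y) = 0"
          using Y by (simp add: B_def)
        then have "A (block N k (flatten N M Y)) \<noteq> 1"
          using k unfolding any_block_def by (metis zero_neq_one)
        moreover have "block N k (flatten N M Y) = Y k"
          using yk k unfolding sp by (intro block_flatten) simp_all
        ultimately show "Y \<in> (\<lambda>Y. Y k) -` {y \<in> space P. A y \<noteq> 1} \<inter> space (planted_at k)"
          using Y yk by simp
      qed
    qed
    also have "\<dots> = measure (distr (planted_at k) P (\<lambda>Y. Y k)) {y \<in> space P. A y \<noteq> 1}"
      unfolding neg by (intro measure_distr[symmetric] comp sets.compl_sets pos)
    also have "distr (planted_at k) P (\<lambda>Y. Y k) = P"
      using distr_PiM_component[of "{..<M}" "\<lambda>j. if j = k then P else Q" k] k P(1) Q(1) by simp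
    also have "measure P {y \<in> space P. A y \<noteq> 1} = 1 - measure P {y \<in> space P. A y = 1}"
      unfolding neg by (rule P.prob_compl[OF pos])
    finally show "(\<integral>Y. indicator B (flatten N M Y) \<partial>planted_at k) \<le>
        1 - measure P {y \<in> space P. A y = 1}" .
  qed
  have "measure (hidden_planted N M P Q) B = (\<integral>z. indicator B z \<partial>hidden_planted N M P Q)"
    using B by (simp add: sets_hidden_planted)
  also have "\<dots> = (\<Sum>k<M. \<integral>Y. indicator B (flatten N M Y) \<partial>planted_at k) / real M"
    using B int by (intro integral_hidden_planted) auto
  also have "\<dots> \<le> (\<Sum>k<M. 1 - measure P {y \<in> space P. A y = 1}) / real M"
    using le by (intro divide_right_mono sum_mono) auto
  also have "\<dots> = 1 - measure P {y \<in> space P. A y = 1}"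
    using M by simp
  finally show ?thesis by (simp add: B_def spH)
qed

end

section \<open>The reduction\<close>

text \<open>Cutting \<open>e k\<close> off at \<open>1 / (k + 1)\<close> changes it at only finitely
  many \<open>n\<close> as far as positive values go, yet makes all but finitely many of the
  sequences uniformly small. The supremum over \<open>k\<close> therefore still tends to 0.\<close>

lemma null_sequences_majorant:
  fixes e :: "nat \<Rightarrow> nat \<Rightarrow> real"
  assumes "\<And>k. e k \<longlonglongrightarrow> 0"
  obtains E where "\<And>n. 0 \<le> E n" and "E \<longlonglongrightarrow> 0" and "\<And>k. \<forall>\<^sub>F n in sequentially. e k n \<le> E n"
proof
  define t where "t = (\<lambda>k n. max 0 (min (e k n) (inverse (real (Suc k)))))"
  define E where "E = (\<lambda>n. SUP k. t k n)"
  have t_le: "t k n \<le> inverse (real (Suc k))" for k n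
    by (simp add: t_def)
  have "t k n \<le> 1" for k n
    using t_le[of k n] by (rule order_trans) (simp add: inverse_eq_divide)
  then have bdd: "bdd_above (range (\<lambda>k. t k n))" for n
    by (intro bdd_aboveI2)
  have t_le_E: "t k n \<le> E n" for k n
    unfolding E_def by (rule cSUP_upper[OF _ bdd]) simp
  show nonneg: "0 \<le> E n" for n
    using t_le_E[of 0 n] by (simp add: t_def)
  show "\<forall>\<^sub>F n in sequentially. e k n \<le> E n" for k
  proof -
    have "\<forall>\<^sub>F n in sequentially. e k n < inverse (real (Suc k))"
      using assms[of k] by (rule order_tendstoD) simp
    then show ?thesis
    proof eventually_elim
      case (elim n)
      then show ?case using t_le_E[of k n] by (simp add: t_def)
    qed
  qed
  show "E \<longlonglongrightarrow> 0"
  proof (rule tendstoI)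
    fix \<eta> :: real assume "0 < \<eta>"
    then have "0 < \<eta> / 2" by simp
    \<comment> \<open>From index \<open>K\<close> on the cut-off is small for every
      \<open>n\<close>; the finitely many sequences below \<open>K\<close> are small for all large
      \<open>n\<close>.\<close>
    then obtain K where K: "inverse (real (Suc K)) < \<eta> / 2"
      using reals_Archimedean by blast
    have "\<forall>\<^sub>F n in sequentially. e k n < \<eta> / 2" for k
      using assms[of k] \<open>0 < \<eta> / 2\<close> by (rule order_tendstoD)
    then have "\<forall>\<^sub>F n in sequentially. \<forall>k\<in>{..<K}. e k n < \<eta> / 2"
      by (intro eventually_ball_finite) simp_all
    then show "\<forall>\<^sub>F n in sequentially. dist (E n) 0 < \<eta>"
    proof eventually_elim
      case (elim n)
      have "t k n \<le> \<eta> / 2" for k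
      proof (cases "k < K")
        case True
        then have "e k n < \<eta> / 2" using elim by simp
        then show ?thesis using \<open>0 < \<eta> / 2\<close> unfolding t_def by linarith
      next
        case False
        then have "inverse (real (Suc k)) \<le> inverse (real (Suc K))"
          by (intro le_imp_inverse_le) auto
        then show ?thesis using t_le[of k n] K by linarith
      qed
      then have "E n \<le> \<eta> / 2"
        unfolding E_def by (intro cSUP_least) auto
      then show ?case using nonneg[of n] \<open>0 < \<eta>\<close> by simp
    qed
  qed
qed

section \<open>Transfer of the test to the hidden problem\<close>

lemma zero_one_valued_any_block:
  assumes "zero_one_valued N A"
  shows "zero_one_valued (\<lambda>n. N n * M n) (\<lambda>n. any_block (N n) (M n) (A n))"
  using assms any_block_measurable by (auto simp: zero_one_valued_def any_block_def)

lemma runs_in_time_any_block: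
  assumes A: "zero_one_valued N A" and run: "runs_in_time N A t" and M: "\<And>n. 0 < M n"
    and t': "\<forall>\<^sub>F n in sequentially. 17 * (real (M n) * t n) \<le> t' n"
  shows "runs_in_time (\<lambda>n. N n * M n) (\<lambda>n. any_block (N n) (M n) (A n)) t'"
  unfolding runs_in_time_def
proof (rule eventually_mono[OF eventually_conj[OF run[unfolded runs_in_time_def] t']])
  fix n
  assume n: "(\<exists>p. \<forall>y\<in>space (Rn (N n)). \<exists>k s. exec (map y [0..<N n]) p init_state k s \<and>
      rreg s 0 = A n y \<and> real (code_length p + k) \<le> t n) \<and> 17 * (real (M n) * t n) \<le> t' n"
  then obtain p where p: "\<And>y. y \<in> space (Rn (N n)) \<Longrightarrow> \<exists>k s. exec (map y [0..<N n]) p init_state k s \<and>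
      rreg s 0 = A n y \<and> real (code_length p + k) \<le> t n" by blast
  have "A n y \<in> {0, 1}" if "y \<in> space (Rn (N n))" for y
    using A that by (simp add: zero_one_valued_def)
  note scan = scan_computes_any_block[OF p this M]
  have "\<exists>k s. exec (map z [0..<N n * M n]) (scan (N n) p (M n)) init_state k s \<and>
      rreg s 0 = any_block (N n) (M n) (A n) z \<and> real (code_length (scan (N n) p (M n)) + k) \<le> t' n" for z
    using scan[of z] n by (meson order_trans)
  then show "\<exists>p. \<forall>z\<in>space (Rn (N n * M n)). \<exists>k s. exec (map z [0..<N n * M n]) p init_state k s \<and>
      rreg s 0 = any_block (N n) (M n) (A n) z \<and> real (code_length p + k) \<le> t' n"
    by blast
qed

text \<open>The exponent \<open>T n\<close> may be negative, so a lower bound on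
  \<open>K * real (N n) powr T n\<close> is not automatic; it comes from the positive length of a
  program that meets the time bound.\<close>

lemma runs_in_time_ge_1:
  assumes "runs_in_time N A t"
  shows "\<forall>\<^sub>F n in sequentially. 1 \<le> t n"
  using assms unfolding runs_in_time_def
proof (rule eventually_mono)
  fix n
  assume "\<exists>p. \<forall>y\<in>space (Rn (N n)). \<exists>k s. exec (map y [0..<N n]) p init_state k s \<and>
      rreg s 0 = A n y \<and> real (code_length p + k) \<le> t n"
  then obtain p k where "real (code_length p + k) \<le> t n"
    using block_in_space by blast
  then show "1 \<le> t n" using code_length_pos[of p] by linarith
qed

text \<open>The error sum is at most \<open>1 - \<delta>\<close> plus
  \<open>\<epsilon> n * real (M n)\<close>, and for large \<open>n\<close> the latter uses up at
  most half of \<delta>.\<close>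

lemma weak_detection_any_block:
  assumes P: "\<And>n. prob_space (P n)" "\<And>n. sets (P n) = sets (Rn (N n))"
    and Q: "\<And>n. prob_space (Q n)" "\<And>n. sets (Q n) = sets (Rn (N n))"
    and M: "\<And>n. 0 < M n" and A: "zero_one_valued N A" and \<delta>: "0 < \<delta>"
    and power: "\<forall>\<^sub>F n in sequentially. \<delta> \<le> measure (P n) {y \<in> space (P n). A n y = 1}"
    and level: "\<forall>\<^sub>F n in sequentially. measure (Q n) {y \<in> space (Q n). A n y = 1} \<le> \<epsilon> n"
    and \<epsilon>: "(\<lambda>n. \<epsilon> n * real (M n)) \<longlonglongrightarrow> 0"
  shows "weak_detection (\<lambda>n. hidden_planted (N n) (M n) (P n) (Q n))
    (\<lambda>n. hidden_null (N n) (M n) (Q n)) (\<lambda>n. any_block (N n) (M n) (A n))"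
  unfolding weak_detection_def
proof (intro exI conjI)
  show "0 < \<delta> / 2" using \<delta> by simp
  have "\<forall>\<^sub>F n in sequentially. \<epsilon> n * real (M n) < \<delta> / 2"
    using \<epsilon> by (rule order_tendstoD) (use \<delta> in simp)
  with power level show "\<forall>\<^sub>F n in sequentially. error_sum (\<lambda>n. hidden_planted (N n) (M n) (P n) (Q n))
    (\<lambda>n. hidden_null (N n) (M n) (Q n)) (\<lambda>n. any_block (N n) (M n) (A n)) n \<le> 1 - \<delta> / 2"
  proof eventually_elim
    case (elim n)
    have A_n: "A n \<in> borel_measurable (Rn (N n))"
      using A by (simp add: zero_one_valued_def)
    have "real (M n) * measure (Q n) {y \<in> space (Q n). A n y = 1} \<le> real (M n) * \<epsilon> n"
      using elim(2) by (intro mult_left_mono) auto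
    then show ?case
      unfolding error_sum_def
      using measure_null_any_block_le[OF P Q M[of n] A_n] measure_planted_any_block_le[OF P Q M[of n] A_n]
        elim(1,3) by (simp add: mult.commute[of "\<epsilon> n"])
  qed
qed

lemma filterlim_sample_number:
  assumes "\<And>n. 1 < \<Delta> n" and "\<And>n. 0 < M n" and "(\<lambda>n. \<Delta> n / real (M n)) \<longlonglongrightarrow> 0"
  shows "filterlim (\<lambda>n. real (M n)) at_top sequentially"
  unfolding filterlim_at_top_gt[where c = 0]
proof (intro allI impI)
  fix B :: real assume B: "0 < B"
  have "\<forall>\<^sub>F n in sequentially. \<Delta> n / real (M n) < 1 / B"
    using assms(3) by (rule order_tendstoD) (use B in simp)
  then show "\<forall>\<^sub>F n in sequentially. B \<le> real (M n)"
  proof eventually_elim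
    case (elim n)
    have "1 / real (M n) \<le> \<Delta> n / real (M n)"
      using assms(1)[of n] by (intro divide_right_mono) auto
    then have "1 / real (M n) < 1 / B" using elim by simp
    then show ?case using B assms(2)[of n] by (simp add: field_simps)
  qed
qed

text \<open>A degree bound \<open>D / C\<close> with the larger constant \<open>C\<close> leaves room for the constant factors
  because \<open>D\<close> tends to infinity: \<open>N\<^sup>T\<close> is bounded below, so \<open>D / C\<close> is at least \<open>ln M\<close> up to
  a constant.\<close>

lemma time_le_heuristic_time:
  assumes \<Delta>: "\<And>n. 1 < \<Delta> n" and M: "\<And>n. 0 < M n"
    and Delta_M: "(\<lambda>n. \<Delta> n / real (M n)) \<longlonglongrightarrow> 0"
    and M_le: "\<forall>\<^sub>F n in sequentially. real (M n) \<le> real (N n) * \<Delta> n"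
    and K: "0 < K" and one_le: "\<forall>\<^sub>F n in sequentially. 1 \<le> K * real (N n) powr T n"
    and D: "\<forall>\<^sub>F n in sequentially. ln (\<Delta> n) + (T n + 1) * ln (real (N n)) \<le> real (D n) / C"
    and C: "0 < C'" "2 * C' \<le> C"
  shows "\<forall>\<^sub>F n in sequentially.
    17 * (real (M n) * (K * real (N n) powr T n)) \<le> heuristic_time (\<lambda>n. N n * M n) D C' n"
proof -
  \<comment> \<open>The bound 2 makes the logarithm of the new dimension \<open>N n * M n\<close>
    positive; \<open>17 * K\<^sup>2\<close> is what turns into \<open>17 * K \<le> ?X\<close>
    below.\<close>
  have "\<forall>\<^sub>F n in sequentially. max 2 (17 * K\<^sup>2) \<le> real (M n)"
    using filterlim_sample_number[OF \<Delta> M Delta_M] unfolding filterlim_at_top by blast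
  with M_le one_le D show ?thesis
  proof eventually_elim
    case (elim n)
    let ?N = "real (N n)" and ?M = "real (M n)" and ?X = "exp (real (D n) / C)"
    have N: "0 < N n"
    proof (rule ccontr)
      assume "\<not> 0 < N n"
      then show False using elim(1) M[of n] by simp
    qed
    have "ln (?N * ?M) > 0"
    proof -
      have "1 * 2 \<le> ?N * ?M" using N elim(4) by (intro mult_mono) auto
      then show ?thesis by simp
    qed
    \<comment> \<open>A power with base \<open>N n * M n\<close> whose exponent is divided by the
      logarithm of that base does not depend on the base, so passing to the larger dimension costs
      nothing here.\<close>
    then have time: "heuristic_time (\<lambda>n. N n * M n) D C' n = exp (real (D n) / C')"
      using N M[of n] by (simp add: heuristic_time_def powr_def)
    have "?M * ?N powr T n \<le> (?N * \<Delta> n) * ?N powr T n"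
      using elim(1) by (intro mult_right_mono) auto
    also have "\<dots> = exp (ln (\<Delta> n) + (T n + 1) * ln ?N)"
      using N \<Delta>[of n] by (simp add: exp_add powr_def algebra_simps)
    also have "\<dots> \<le> ?X" using elim(3) by simp
    finally have MX: "?M * (K * ?N powr T n) \<le> K * ?X"
      using K by (simp add: mult.left_commute)
    have "17 * K\<^sup>2 \<le> ?M * 1" using elim(4) by simp
    also have "\<dots> \<le> ?M * (K * ?N powr T n)"
      using elim(2) by (intro mult_left_mono) auto
    also note MX
    finally have "17 * K \<le> ?X"
      using K by (simp add: power2_eq_square)
    have "17 * (?M * (K * ?N powr T n)) \<le> 17 * K * ?X"
      using MX by simp
    \<comment> \<open>One factor \<open>?X\<close> pays for the constant \<open>17 * K\<close>;
      squaring halves the constant in the exponent, whence the hypothesis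
      \<open>2 * C' \<le> C\<close>.\<close>
    also have "\<dots> \<le> ?X * ?X"
      using \<open>17 * K \<le> ?X\<close> by (intro mult_right_mono) auto
    also have "\<dots> = exp (real (D n) / (C / 2))"
      by (simp add: exp_add[symmetric])
    also have "\<dots> \<le> exp (real (D n) / C')"
      unfolding exp_le_cancel_iff using C by (intro divide_left_mono) auto
    finally show ?case unfolding time .
  qed
qed

lemma Adv_hidden_tendsto_1:
  assumes P: "\<And>n. prob_space (P n)" "\<And>n. sets (P n) = sets (Rn (N n))"
    and Q: "\<And>n. prob_space (Q n)" "\<And>n. sets (Q n) = sets (Rn (N n))"
    and moments: "\<And>n f. f \<in> polys_le (N n) (D n) \<Longrightarrow>
          integrable (P n) f \<and> integrable (Q n) (\<lambda>y. (f y)\<^sup>2)"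
    and Delta: "\<And>n. \<Delta> n > 1"
    and Adv: "\<And>n. (Adv (N n) (D n) (P n) (Q n))\<^sup>2 \<le> ereal (\<Delta> n)"
    and M: "\<And>n. 0 < M n" and Delta_M: "(\<lambda>n. \<Delta> n / real (M n)) \<longlonglongrightarrow> 0"
  shows "(\<lambda>n. Adv (N n * M n) (D n) (hidden_planted (N n) (M n) (P n) (Q n))
    (hidden_null (N n) (M n) (Q n))) \<longlonglongrightarrow> 1"
proof (rule tendsto_sandwich[OF always_eventually always_eventually])
  \<comment> \<open>A finite bound on the square excludes the value \<open>\<infinity>\<close>, so
    the root can be taken among the reals.\<close>
  have Adv_le: "Adv (N n) (D n) (P n) (Q n) \<le> ereal (sqrt (\<Delta> n))" for n
    using Adv[of n]
    by (cases "Adv (N n) (D n) (P n) (Q n)") (auto intro: real_le_rsqrt)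
  show "\<forall>n. Adv (N n * M n) (D n) (hidden_planted (N n) (M n) (P n) (Q n))
      (hidden_null (N n) (M n) (Q n)) \<le> ereal (sqrt (1 + \<Delta> n / real (M n)))"
  proof
    fix n
    have "0 \<le> \<Delta> n" using Delta[of n] by simp
    then show "Adv (N n * M n) (D n) (hidden_planted (N n) (M n) (P n) (Q n))
        (hidden_null (N n) (M n) (Q n)) \<le> ereal (sqrt (1 + \<Delta> n / real (M n)))"
      using Adv_hidden_le[OF P Q M moments _ Adv_le, of n] by simp
  qed
  show "\<forall>n. 1 \<le> Adv (N n * M n) (D n) (hidden_planted (N n) (M n) (P n) (Q n))
      (hidden_null (N n) (M n) (Q n))"
    using Adv_hidden_ge_1[OF P Q M] by blast
  have "(\<lambda>n. sqrt (1 + \<Delta> n / real (M n))) \<longlonglongrightarrow> sqrt (1 + 0)"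
    by (intro tendsto_intros Delta_M)
  then show "(\<lambda>n. ereal (sqrt (1 + \<Delta> n / real (M n)))) \<longlonglongrightarrow> 1"
    by (simp add: one_ereal_def)
qed simp

theorem proposition1p6:
  fixes N D :: "nat \<Rightarrow> nat"
    and P Q :: "nat \<Rightarrow> (nat \<Rightarrow> real) measure"
    and \<Delta> :: "nat \<Rightarrow> real"
  assumes P: "\<And>n. prob_space (P n)" "\<And>n. sets (P n) = sets (Rn (N n))"
    and Q: "\<And>n. prob_space (Q n)" "\<And>n. sets (Q n) = sets (Rn (N n))"
    and moments: "\<And>n f. f \<in> polys_le (N n) (D n) \<Longrightarrow>
          integrable (P n) f \<and> integrable (Q n) (\<lambda>y. (f y)\<^sup>2)"
    and Delta: "\<And>n. \<Delta> n > 1"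
    and Adv: "\<And>n. (Adv (N n) (D n) (P n) (Q n))\<^sup>2 \<le> ereal (\<Delta> n)"
    and heuristic: "\<And>\<epsilon> :: nat \<Rightarrow> real.
          (\<forall>n. 0 \<le> \<epsilon> n) \<Longrightarrow> (\<lambda>n. \<epsilon> n * \<Delta> n) \<longlonglongrightarrow> 0 \<Longrightarrow>
          \<exists>M :: nat \<Rightarrow> nat.
            (\<forall>n. 0 < M n) \<and>
            (\<lambda>n. \<Delta> n / real (M n)) \<longlonglongrightarrow> 0 \<and>
            (\<forall>\<^sub>F n in sequentially. real (M n) \<le> real (N n) * \<Delta> n) \<and>
            (\<lambda>n. \<epsilon> n * real (M n)) \<longlonglongrightarrow> 0 \<and>
            low_degree_heuristic (\<lambda>n. N n * M n) D
              (\<lambda>n. hidden_planted (N n) (M n) (P n) (Q n))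
              (\<lambda>n. hidden_null (N n) (M n) (Q n))"
  shows "\<exists>C>0. \<forall>T c \<epsilon> :: nat \<Rightarrow> real.
           (\<forall>\<^sub>F n in sequentially.
              ln (\<Delta> n) + (T n + 1) * ln (real (N n)) \<le> real (D n) / C) \<and>
           (\<exists>\<delta>>0. \<forall>\<^sub>F n in sequentially. \<delta> \<le> c n) \<and>
           (\<lambda>n. \<epsilon> n * \<Delta> n) \<longlonglongrightarrow> 0 \<longrightarrow>
           \<not> (\<exists>A. is_TCE_test N P Q T c \<epsilon> A)"
proof (rule ccontr)
  assume contr: "\<not> ?thesis"
  define bad where "bad = (\<lambda>k T c \<epsilon> A.
      (\<forall>\<^sub>F n in sequentially.
        ln (\<Delta> n) + (T n + 1) * ln (real (N n)) \<le> real (D n) / real (Suc k)) \<and>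
      (\<exists>\<delta>>0. \<forall>\<^sub>F n in sequentially. \<delta> \<le> c n) \<and> (\<lambda>n. \<epsilon> n * \<Delta> n) \<longlonglongrightarrow> 0 \<and>
      is_TCE_test N P Q T c \<epsilon> A)"
  have "\<exists>T c \<epsilon> A. bad k T c \<epsilon> A" for k
  proof -
    have "0 < real (Suc k)" by simp
    with contr show ?thesis unfolding bad_def by blast
  qed
  then obtain T c \<epsilon> A where bad: "\<And>k. bad k (T k) (c k) (\<epsilon> k) (A k)"
    by metis
  have
    D: "\<And>k. \<forall>\<^sub>F n in sequentially.
        ln (\<Delta> n) + (T k n + 1) * ln (real (N n)) \<le> real (D n) / real (Suc k)" and
    c: "\<And>k. \<exists>\<delta>>0. \<forall>\<^sub>F n in sequentially. \<delta> \<le> c k n" and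
    \<epsilon>: "\<And>k. (\<lambda>n. \<epsilon> k n * \<Delta> n) \<longlonglongrightarrow> 0" and
    test: "\<And>k. is_TCE_test N P Q (T k) (c k) (\<epsilon> k) (A k)"
    using bad unfolding bad_def by blast+
  obtain E where E: "\<And>n. 0 \<le> E n" "E \<longlonglongrightarrow> 0"
    "\<And>k. \<forall>\<^sub>F n in sequentially. \<epsilon> k n * \<Delta> n \<le> E n"
    using null_sequences_majorant[of "\<lambda>k n. \<epsilon> k n * \<Delta> n", OF \<epsilon>] by blast
  have pos: "0 < \<Delta> n" for n using Delta[of n] by simp
  \<comment> \<open>\<open>E n / \<Delta> n\<close> is the common level submitted to the heuristic:
    for each \<open>k\<close> it eventually dominates \<open>\<epsilon> k n\<close>.\<close>
  have "\<forall>n. 0 \<le> E n / \<Delta> n" using E(1) pos by (simp add: less_imp_le)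
  moreover have "E n / \<Delta> n * \<Delta> n = E n" for n using pos[of n] by simp
  then have "(\<lambda>n. E n / \<Delta> n * \<Delta> n) \<longlonglongrightarrow> 0" using E(2) by simp
  ultimately have "\<exists>M :: nat \<Rightarrow> nat.
            (\<forall>n. 0 < M n) \<and>
            (\<lambda>n. \<Delta> n / real (M n)) \<longlonglongrightarrow> 0 \<and>
            (\<forall>\<^sub>F n in sequentially. real (M n) \<le> real (N n) * \<Delta> n) \<and>
            (\<lambda>n. E n / \<Delta> n * real (M n)) \<longlonglongrightarrow> 0 \<and>
            low_degree_heuristic (\<lambda>n. N n * M n) D
              (\<lambda>n. hidden_planted (N n) (M n) (P n) (Q n))
              (\<lambda>n. hidden_null (N n) (M n) (Q n))"
    by (rule heuristic)
  then obtain M where M: "\<And>n. 0 < M n" and Delta_M: "(\<lambda>n. \<Delta> n / real (M n)) \<longlonglongrightarrow> 0"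
    and M_le: "\<forall>\<^sub>F n in sequentially. real (M n) \<le> real (N n) * \<Delta> n"
    and EM: "(\<lambda>n. E n / \<Delta> n * real (M n)) \<longlonglongrightarrow> 0"
    and ldh: "low_degree_heuristic (\<lambda>n. N n * M n) D
              (\<lambda>n. hidden_planted (N n) (M n) (P n) (Q n))
              (\<lambda>n. hidden_null (N n) (M n) (Q n))"
    by blast
  have "(\<lambda>n. Adv (N n * M n) (D n) (hidden_planted (N n) (M n) (P n) (Q n))
      (hidden_null (N n) (M n) (Q n))) \<longlonglongrightarrow> 1"
    by (rule Adv_hidden_tendsto_1[OF P Q moments Delta Adv M Delta_M])
  with ldh obtain C where C: "0 < C" and
    no_test: "\<And>B. zero_one_valued (\<lambda>n. N n * M n) B \<Longrightarrow>
      runs_in_time (\<lambda>n. N n * M n) B (heuristic_time (\<lambda>n. N n * M n) D C) \<Longrightarrow>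
      \<not> weak_detection (\<lambda>n. hidden_planted (N n) (M n) (P n) (Q n))
          (\<lambda>n. hidden_null (N n) (M n) (Q n)) B"
    unfolding low_degree_heuristic_def by blast
  \<comment> \<open>\<open>M\<close> and \<open>C\<close> were fixed without reference to
    \<open>k\<close>, so the counterexample may be picked only now; the factor 2 is the room that
    \<open>time_le_heuristic_time\<close> requires.\<close>
  define k where "k = nat \<lceil>2 * C\<rceil>"
  have k: "2 * C \<le> real (Suc k)" unfolding k_def using C by linarith
  obtain K where A: "zero_one_valued N (A k)" and K: "0 < K"
    and run: "runs_in_time N (A k) (\<lambda>n. K * real (N n) powr T k n)"
    and err: "\<forall>\<^sub>F n in sequentially.
        c k n \<le> measure (P n) {y \<in> space (P n). A k n y = 1} \<and>
        measure (Q n) {y \<in> space (Q n). A k n y = 1} \<le> \<epsilon> k n"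
    using test[of k] unfolding is_TCE_test_def by blast
  obtain \<delta> where \<delta>: "0 < \<delta>" "\<forall>\<^sub>F n in sequentially. \<delta> \<le> c k n" using c by blast
  from \<delta>(2) err have power: "\<forall>\<^sub>F n in sequentially. \<delta> \<le> measure (P n) {y \<in> space (P n). A k n y = 1}"
    by eventually_elim simp
  from err E(3)[of k] have level: "\<forall>\<^sub>F n in sequentially.
      measure (Q n) {y \<in> space (Q n). A k n y = 1} \<le> E n / \<Delta> n"
  proof eventually_elim
    case (elim n)
    then have "\<epsilon> k n \<le> E n / \<Delta> n" using pos[of n] by (simp add: pos_le_divide_eq)
    then show ?case using elim by simp
  qed
  have "weak_detection (\<lambda>n. hidden_planted (N n) (M n) (P n) (Q n))
      (\<lambda>n. hidden_null (N n) (M n) (Q n)) (\<lambda>n. any_block (N n) (M n) (A k n))"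
    by (rule weak_detection_any_block[OF P Q M A \<delta>(1) power level EM])
  moreover have "runs_in_time (\<lambda>n. N n * M n) (\<lambda>n. any_block (N n) (M n) (A k n))
      (heuristic_time (\<lambda>n. N n * M n) D C)"
    by (rule runs_in_time_any_block[OF A run M time_le_heuristic_time[OF Delta M Delta_M M_le K
          runs_in_time_ge_1[OF run] D C k]])
  ultimately show False
    using no_test[OF zero_one_valued_any_block[OF A]] by blast
qed

end
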